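(* Let $(\mathcal{C},\otimes,1)$ be a right closed monoidal category and let $x\in\mathcal{C}$. The lax module functor $\underline{\mathrm{Hom}}^{\mathrm r}(x,-)\colon\mathcal{C}\to\mathcal{C}$ is a strong module functor if and only if $x$ has a right dual object $x^\vee$. Moreover, if this is the case, then $x^\vee\cong\underline{\mathrm{Hom}}^{\mathrm r}(x,1)$ as objects, and $$\underline{\mathrm{Hom}}^{\mathrm r}(x,-)\;\cong\;{-}\otimes x^\vee$$ as module functors.
   Context: Monoidal categories are linear over a fixed algebraically closed field $\Bbbk$. Internal Hom. For $y,z\in\mathcal{C}$, the internal Hom $\underline{\mathrm{Hom}}^{\mathrm r}(y,z)\in\mathcal{C}$ is an object representing the functor $w\mapsto\mathrm{Hom}(w\otimes y,z)$, i.e. there are natural isomorphisms $\mathrm{Hom}(w\otimes y,z)\cong\mathrm{Hom}(w,\underline{\mathrm{Hom}}^{\mathrm r}(y,z))$. $\mathcal{C}$ is right closed if $\underline{\mathrm{Hom}}^{\mathrm r}(y,z)$ exists for all $y,z$. Thus $\underline{\mathrm{Hom}}^{\mathrm r}(x,-)$ is right adjoint to ${-}\otimes x$. Let $\mathrm{ev}_{x,y}\colon\underline{\mathrm{Hom}}^{\mathrm r}(x,y)\otimes x\to y$ be the counit. Module functors. $\mathcal{C}$ is regarded as a left module category over itself via $\otimes$. A lax (left) module functor $F\colon\mathcal{C}\to\mathcal{C}$ is a functor with a natural family of morphisms $c\otimes F(y)\to F(c\otimes y)$ (the module constraint) satisfying the usual coherence with associator and unit; it is strong if all constraint morphisms are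 isomorphisms. An isomorphism of module functors is a natural isomorphism compatible with the constraints. The functor ${-}\otimes z$ is a strong module functor with constraint given by the associator. Lax structure on the internal Hom. As right adjoint of the strong module functor ${-}\otimes x$, the functor $\underline{\mathrm{Hom}}^{\mathrm r}(x,-)$ is a lax module functor in the unique way for which unit and counit of the adjunction are module natural transformations: its constraint $c\otimes\underline{\mathrm{Hom}}^{\mathrm r}(x,y)\to\underline{\mathrm{Hom}}^{\mathrm r}(x,c\otimes y)$ is the morphism corresponding under the adjunction to the composite of the associator $(c\otimes\underline{\mathrm{Hom}}^{\mathrm r}(x,y))\otimes x\to c\otimes(\underline{\mathrm{Hom}}^{\mathrm r}(x,y)\otimes x)$ with $\mathrm{id}_c\otimes\mathrm{ev}_{x,y}$. Right dual. A right dual of $x$ is an object $x^\vee$ with morphisms $x^\vee\otimes x\to1$ (evaluation) and $1\to x\otimes x^\vee$ (coevaluation) satisfying the two zig-zag identities. *)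

theory Defs
  imports "HOL-Algebra.Algebraic_Closure"
begin

section \<open>Linear monoidal categories\<close>

text \<open>
  Categories have a set of objects and a set of arrows. Composition is in the applicative
  order, so \<open>g \<bullet>\<^bsub>C\<^esub> f\<close> is \<open>f\<close> followed by \<open>g\<close>. Operations are
  unconstrained outside these sets.
\<close>

record ('o, 'm) category_data =
  Ob :: "'o set"
  Arr :: "'m set"
  Dom :: "'m \<Rightarrow> 'o"
  Cod :: "'m \<Rightarrow> 'o"
  Ident :: "'o \<Rightarrow> 'm"
  Comp :: "'m \<Rightarrow> 'm \<Rightarrow> 'm" (infixr \<open>\<bullet>\<index>\<close> 70)

record ('o, 'm, 'k) linear_category_data = "('o, 'm) category_data" +
  ArrZero :: "'o \<Rightarrow> 'o \<Rightarrow> 'm"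
  ArrAdd :: "'m \<Rightarrow> 'm \<Rightarrow> 'm"
  ArrScale :: "'k \<Rightarrow> 'm \<Rightarrow> 'm"

record ('o, 'm, 'k) monoidal_data = "('o, 'm, 'k) linear_category_data" +
  TensorOb :: "'o \<Rightarrow> 'o \<Rightarrow> 'o" (infixr \<open>\<otimes>\<^sub>o\<index>\<close> 75)
  TensorArr :: "'m \<Rightarrow> 'm \<Rightarrow> 'm" (infixr \<open>\<otimes>\<^sub>m\<index>\<close> 75)
  UnitOb :: "'o"
  Assoc :: "'o \<Rightarrow> 'o \<Rightarrow> 'o \<Rightarrow> 'm"
  LUnit :: "'o \<Rightarrow> 'm"
  RUnit :: "'o \<Rightarrow> 'm"

definition Hom :: "('o, 'm, 'x) category_data_scheme \<Rightarrow> 'o \<Rightarrow> 'o \<Rightarrow> 'm set" where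
  "Hom C a b = {f \<in> Arr C. Dom C f = a \<and> Cod C f = b}"

definition inverse_arrows :: "('o, 'm, 'x) category_data_scheme \<Rightarrow> 'm \<Rightarrow> 'm \<Rightarrow> bool" where
  "inverse_arrows C f g \<longleftrightarrow>
     f \<in> Arr C \<and> g \<in> Hom C (Cod C f) (Dom C f) \<and>
     g \<bullet>\<^bsub>C\<^esub> f = Ident C (Dom C f) \<and> f \<bullet>\<^bsub>C\<^esub> g = Ident C (Cod C f)"

definition iso_arr :: "('o, 'm, 'x) category_data_scheme \<Rightarrow> 'm \<Rightarrow> bool" where
  "iso_arr C f \<longleftrightarrow> (\<exists>g. inverse_arrows C f g)"

definition inv_arr :: "('o, 'm, 'x) category_data_scheme \<Rightarrow> 'm \<Rightarrow> 'm" where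
  "inv_arr C f = (THE g. inverse_arrows C f g)"

definition isomorphic_ob :: "('o, 'm, 'x) category_data_scheme \<Rightarrow> 'o \<Rightarrow> 'o \<Rightarrow> bool" where
  "isomorphic_ob C a b \<longleftrightarrow> (\<exists>f \<in> Hom C a b. iso_arr C f)"

text \<open>
  The multiplicative part of a \<^typ>\<open>('k, 'm) module\<close> record is not used by the locale
  \<^locale>\<open>module\<close>.
\<close>

definition hom_space ::
  "('o, 'm, 'k, 'x) linear_category_data_scheme \<Rightarrow> 'o \<Rightarrow> 'o \<Rightarrow> ('k, 'm) module" where
  "hom_space C a b =
     \<lparr>carrier = Hom C a b, monoid.mult = undefined, one = undefined,
      zero = ArrZero C a b, add = ArrAdd C, smult = ArrScale C\<rparr>"

locale category =
  fixes C :: "('o, 'm, 'x) category_data_scheme" (structure)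
  assumes Dom_closed: "f \<in> Arr C \<Longrightarrow> Dom C f \<in> Ob C"
    and Cod_closed: "f \<in> Arr C \<Longrightarrow> Cod C f \<in> Ob C"
    and Ident_closed: "a \<in> Ob C \<Longrightarrow> Ident C a \<in> Hom C a a"
    and Comp_closed: "f \<in> Hom C a b \<Longrightarrow> g \<in> Hom C b c \<Longrightarrow> g \<bullet> f \<in> Hom C a c"
    and Comp_Ident_left: "f \<in> Hom C a b \<Longrightarrow> Ident C b \<bullet> f = f"
    and Comp_Ident_right: "f \<in> Hom C a b \<Longrightarrow> f \<bullet> Ident C a = f"
    and Comp_assoc: "f \<in> Hom C a b \<Longrightarrow> g \<in> Hom C b c \<Longrightarrow> h \<in> Hom C c d \<Longrightarrow>
          (h \<bullet> g) \<bullet> f = h \<bullet> (g \<bullet> f)"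

locale linear_category = category C
  for K :: "('k, 'r) ring_scheme" and C :: "('o, 'm, 'k, 'x) linear_category_data_scheme" (structure) +
  assumes scalars_field: "field K"
    and hom_space_module: "a \<in> Ob C \<Longrightarrow> b \<in> Ob C \<Longrightarrow> module K (hom_space C a b)"
    and Comp_add_left: "f \<in> Hom C a b \<Longrightarrow> g \<in> Hom C b c \<Longrightarrow> g' \<in> Hom C b c \<Longrightarrow>
          ArrAdd C g g' \<bullet> f = ArrAdd C (g \<bullet> f) (g' \<bullet> f)"
    and Comp_add_right: "f \<in> Hom C a b \<Longrightarrow> f' \<in> Hom C a b \<Longrightarrow> g \<in> Hom C b c \<Longrightarrow>
          g \<bullet> ArrAdd C f f' = ArrAdd C (g \<bullet> f) (g \<bullet> f')"
    and Comp_scale_left: "k \<in> carrier K \<Longrightarrow> f \<in> Hom C a b \<Longrightarrow> g \<in> Hom C b c \<Longrightarrow>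
          ArrScale C k g \<bullet> f = ArrScale C k (g \<bullet> f)"
    and Comp_scale_right: "k \<in> carrier K \<Longrightarrow> f \<in> Hom C a b \<Longrightarrow> g \<in> Hom C b c \<Longrightarrow>
          g \<bullet> ArrScale C k f = ArrScale C k (g \<bullet> f)"

locale linear_monoidal_category = linear_category K C
  for K :: "('k, 'r) ring_scheme" and C :: "('o, 'm, 'k, 'x) monoidal_data_scheme" (structure) +
  assumes UnitOb_closed: "UnitOb C \<in> Ob C"
    and TensorOb_closed: "a \<in> Ob C \<Longrightarrow> b \<in> Ob C \<Longrightarrow> a \<otimes>\<^sub>o b \<in> Ob C"
    and TensorArr_closed: "f \<in> Hom C a b \<Longrightarrow> f' \<in> Hom C a' b' \<Longrightarrow>
          f \<otimes>\<^sub>m f' \<in> Hom C (a \<otimes>\<^sub>o a') (b \<otimes>\<^sub>o b')"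
    and TensorArr_Ident: "a \<in> Ob C \<Longrightarrow> b \<in> Ob C \<Longrightarrow>
          Ident C a \<otimes>\<^sub>m Ident C b = Ident C (a \<otimes>\<^sub>o b)"
    and TensorArr_Comp: "f \<in> Hom C a b \<Longrightarrow> g \<in> Hom C b c \<Longrightarrow> f' \<in> Hom C a' b' \<Longrightarrow> g' \<in> Hom C b' c' \<Longrightarrow>
          (g \<bullet> f) \<otimes>\<^sub>m (g' \<bullet> f') = (g \<otimes>\<^sub>m g') \<bullet> (f \<otimes>\<^sub>m f')"
    and TensorArr_add_left: "f \<in> Hom C a b \<Longrightarrow> f' \<in> Hom C a b \<Longrightarrow> g \<in> Hom C c d \<Longrightarrow>
          ArrAdd C f f' \<otimes>\<^sub>m g = ArrAdd C (f \<otimes>\<^sub>m g) (f' \<otimes>\<^sub>m g)"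
    and TensorArr_add_right: "f \<in> Hom C a b \<Longrightarrow> g \<in> Hom C c d \<Longrightarrow> g' \<in> Hom C c d \<Longrightarrow>
          f \<otimes>\<^sub>m ArrAdd C g g' = ArrAdd C (f \<otimes>\<^sub>m g) (f \<otimes>\<^sub>m g')"
    and TensorArr_scale_left: "k \<in> carrier K \<Longrightarrow> f \<in> Hom C a b \<Longrightarrow> g \<in> Hom C c d \<Longrightarrow>
          ArrScale C k f \<otimes>\<^sub>m g = ArrScale C k (f \<otimes>\<^sub>m g)"
    and TensorArr_scale_right: "k \<in> carrier K \<Longrightarrow> f \<in> Hom C a b \<Longrightarrow> g \<in> Hom C c d \<Longrightarrow>
          f \<otimes>\<^sub>m ArrScale C k g = ArrScale C k (f \<otimes>\<^sub>m g)"
    and Assoc_closed: "a \<in> Ob C \<Longrightarrow> b \<in> Ob C \<Longrightarrow> c \<in> Ob C \<Longrightarrow>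
          Assoc C a b c \<in> Hom C ((a \<otimes>\<^sub>o b) \<otimes>\<^sub>o c) (a \<otimes>\<^sub>o (b \<otimes>\<^sub>o c))"
    and Assoc_iso: "a \<in> Ob C \<Longrightarrow> b \<in> Ob C \<Longrightarrow> c \<in> Ob C \<Longrightarrow> iso_arr C (Assoc C a b c)"
    and Assoc_natural: "f \<in> Hom C a a' \<Longrightarrow> g \<in> Hom C b b' \<Longrightarrow> h \<in> Hom C c c' \<Longrightarrow>
          Assoc C a' b' c' \<bullet> ((f \<otimes>\<^sub>m g) \<otimes>\<^sub>m h) = (f \<otimes>\<^sub>m (g \<otimes>\<^sub>m h)) \<bullet> Assoc C a b c"
    and LUnit_closed: "a \<in> Ob C \<Longrightarrow> LUnit C a \<in> Hom C (UnitOb C \<otimes>\<^sub>o a) a"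
    and LUnit_iso: "a \<in> Ob C \<Longrightarrow> iso_arr C (LUnit C a)"
    and LUnit_natural: "f \<in> Hom C a b \<Longrightarrow>
          LUnit C b \<bullet> (Ident C (UnitOb C) \<otimes>\<^sub>m f) = f \<bullet> LUnit C a"
    and RUnit_closed: "a \<in> Ob C \<Longrightarrow> RUnit C a \<in> Hom C (a \<otimes>\<^sub>o UnitOb C) a"
    and RUnit_iso: "a \<in> Ob C \<Longrightarrow> iso_arr C (RUnit C a)"
    and RUnit_natural: "f \<in> Hom C a b \<Longrightarrow>
          RUnit C b \<bullet> (f \<otimes>\<^sub>m Ident C (UnitOb C)) = f \<bullet> RUnit C a"
    and pentagon: "a \<in> Ob C \<Longrightarrow> b \<in> Ob C \<Longrightarrow> c \<in> Ob C \<Longrightarrow> d \<in> Ob C \<Longrightarrow>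
          Assoc C a b (c \<otimes>\<^sub>o d) \<bullet> Assoc C (a \<otimes>\<^sub>o b) c d =
          (Ident C a \<otimes>\<^sub>m Assoc C b c d) \<bullet> Assoc C a (b \<otimes>\<^sub>o c) d \<bullet> (Assoc C a b c \<otimes>\<^sub>m Ident C d)"
    and triangle: "a \<in> Ob C \<Longrightarrow> b \<in> Ob C \<Longrightarrow>
          (Ident C a \<otimes>\<^sub>m LUnit C b) \<bullet> Assoc C a (UnitOb C) b = RUnit C a \<otimes>\<^sub>m Ident C b"


section \<open>Module endofunctors of the regular module category\<close>

text \<open>\<open>FCon F c y\<close> is the module constraint \<open>c \<otimes> F y \<rightarrow> F (c \<otimes> y)\<close>.\<close>

record ('o, 'm) module_functor_data =
  FOb :: "'o \<Rightarrow> 'o"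
  FArr :: "'m \<Rightarrow> 'm"
  FCon :: "'o \<Rightarrow> 'o \<Rightarrow> 'm"

text \<open>As the categories are linear, functors are required to be linear on hom spaces.\<close>

definition linear_endofunctor ::
  "('k, 'r) ring_scheme \<Rightarrow> ('o, 'm, 'k, 'x) linear_category_data_scheme \<Rightarrow>
   ('o \<Rightarrow> 'o) \<Rightarrow> ('m \<Rightarrow> 'm) \<Rightarrow> bool" where
  "linear_endofunctor K C Fo Fa \<longleftrightarrow>
     (\<forall>a \<in> Ob C. Fo a \<in> Ob C) \<and>
     (\<forall>a b f. f \<in> Hom C a b \<longrightarrow> Fa f \<in> Hom C (Fo a) (Fo b)) \<and>
     (\<forall>a \<in> Ob C. Fa (Ident C a) = Ident C (Fo a)) \<and>
     (\<forall>a b c f g. f \<in> Hom C a b \<longrightarrow> g \<in> Hom C b c \<longrightarrow> Fa (g \<bullet>\<^bsub>C\<^esub> f) = Fa g \<bullet>\<^bsub>C\<^esub> Fa f) \<and>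
     (\<forall>a b f g. f \<in> Hom C a b \<longrightarrow> g \<in> Hom C a b \<longrightarrow>
        Fa (ArrAdd C f g) = ArrAdd C (Fa f) (Fa g)) \<and>
     (\<forall>k \<in> carrier K. \<forall>f \<in> Arr C. Fa (ArrScale C k f) = ArrScale C k (Fa f))"

definition lax_module_functor ::
  "('k, 'r) ring_scheme \<Rightarrow> ('o, 'm, 'k, 'x) monoidal_data_scheme \<Rightarrow>
   ('o, 'm) module_functor_data \<Rightarrow> bool" where
  "lax_module_functor K C F \<longleftrightarrow>
     linear_endofunctor K C (FOb F) (FArr F) \<and>
     (\<forall>c \<in> Ob C. \<forall>y \<in> Ob C. FCon F c y \<in> Hom C (c \<otimes>\<^sub>o\<^bsub>C\<^esub> FOb F y) (FOb F (c \<otimes>\<^sub>o\<^bsub>C\<^esub> y))) \<and>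
     (\<forall>c c' y y' f g. f \<in> Hom C c c' \<longrightarrow> g \<in> Hom C y y' \<longrightarrow>
        FArr F (f \<otimes>\<^sub>m\<^bsub>C\<^esub> g) \<bullet>\<^bsub>C\<^esub> FCon F c y = FCon F c' y' \<bullet>\<^bsub>C\<^esub> (f \<otimes>\<^sub>m\<^bsub>C\<^esub> FArr F g)) \<and>
     (\<forall>c \<in> Ob C. \<forall>d \<in> Ob C. \<forall>y \<in> Ob C.
        FArr F (Assoc C c d y) \<bullet>\<^bsub>C\<^esub> FCon F (c \<otimes>\<^sub>o\<^bsub>C\<^esub> d) y =
        FCon F c (d \<otimes>\<^sub>o\<^bsub>C\<^esub> y) \<bullet>\<^bsub>C\<^esub> (Ident C c \<otimes>\<^sub>m\<^bsub>C\<^esub> FCon F d y) \<bullet>\<^bsub>C\<^esub> Assoc C c d (FOb F y)) \<and>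
     (\<forall>y \<in> Ob C. FArr F (LUnit C y) \<bullet>\<^bsub>C\<^esub> FCon F (UnitOb C) y = LUnit C (FOb F y))"

definition strong_module_functor ::
  "('k, 'r) ring_scheme \<Rightarrow> ('o, 'm, 'k, 'x) monoidal_data_scheme \<Rightarrow>
   ('o, 'm) module_functor_data \<Rightarrow> bool" where
  "strong_module_functor K C F \<longleftrightarrow>
     lax_module_functor K C F \<and> (\<forall>c \<in> Ob C. \<forall>y \<in> Ob C. iso_arr C (FCon F c y))"

definition module_functor_iso ::
  "('o, 'm, 'k, 'x) monoidal_data_scheme \<Rightarrow> ('o, 'm) module_functor_data \<Rightarrow>
   ('o, 'm) module_functor_data \<Rightarrow> ('o \<Rightarrow> 'm) \<Rightarrow> bool" where
  "module_functor_iso C F G \<eta> \<longleftrightarrow>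
     (\<forall>y \<in> Ob C. \<eta> y \<in> Hom C (FOb F y) (FOb G y) \<and> iso_arr C (\<eta> y)) \<and>
     (\<forall>y z f. f \<in> Hom C y z \<longrightarrow> FArr G f \<bullet>\<^bsub>C\<^esub> \<eta> y = \<eta> z \<bullet>\<^bsub>C\<^esub> FArr F f) \<and>
     (\<forall>c \<in> Ob C. \<forall>y \<in> Ob C.
        \<eta> (c \<otimes>\<^sub>o\<^bsub>C\<^esub> y) \<bullet>\<^bsub>C\<^esub> FCon F c y = FCon G c y \<bullet>\<^bsub>C\<^esub> (Ident C c \<otimes>\<^sub>m\<^bsub>C\<^esub> \<eta> y))"

definition isomorphic_module_functors ::
  "('k, 'r) ring_scheme \<Rightarrow> ('o, 'm, 'k, 'x) monoidal_data_scheme \<Rightarrow>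
   ('o, 'm) module_functor_data \<Rightarrow> ('o, 'm) module_functor_data \<Rightarrow> bool" where
  "isomorphic_module_functors K C F G \<longleftrightarrow>
     lax_module_functor K C F \<and> lax_module_functor K C G \<and> (\<exists>\<eta>. module_functor_iso C F G \<eta>)"

definition tensor_right_functor ::
  "('o, 'm, 'k, 'x) monoidal_data_scheme \<Rightarrow> 'o \<Rightarrow> ('o, 'm) module_functor_data" where
  "tensor_right_functor C z =
     \<lparr>FOb = (\<lambda>y. y \<otimes>\<^sub>o\<^bsub>C\<^esub> z),
      FArr = (\<lambda>f. f \<otimes>\<^sub>m\<^bsub>C\<^esub> Ident C z),
      FCon = (\<lambda>c y. inv_arr C (Assoc C c y z))\<rparr>"


section \<open>Internal homs\<close>

text \<open>
  \<open>is_internal_hom C y z h \<phi>\<close>: the object \<open>h\<close> represents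
  \<open>w \<mapsto> Hom (w \<otimes> y) z\<close>, via the natural isomorphism with components
  \<open>\<phi> w : Hom (w \<otimes> y) z \<rightarrow> Hom w h\<close>. Linearity of \<open>\<phi> w\<close> need not be required:
  by naturality its inverse is \<open>u \<mapsto> ev \<bullet> (u \<otimes> id)\<close>.
\<close>

definition is_internal_hom ::
  "('o, 'm, 'k, 'x) monoidal_data_scheme \<Rightarrow> 'o \<Rightarrow> 'o \<Rightarrow> 'o \<Rightarrow> ('o \<Rightarrow> 'm \<Rightarrow> 'm) \<Rightarrow> bool" where
  "is_internal_hom C y z h \<phi> \<longleftrightarrow>
     h \<in> Ob C \<and>
     (\<forall>w \<in> Ob C. bij_betw (\<phi> w) (Hom C (w \<otimes>\<^sub>o\<^bsub>C\<^esub> y) z) (Hom C w h)) \<and>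
     (\<forall>w w' u g. u \<in> Hom C w' w \<longrightarrow> g \<in> Hom C (w \<otimes>\<^sub>o\<^bsub>C\<^esub> y) z \<longrightarrow>
        \<phi> w' (g \<bullet>\<^bsub>C\<^esub> (u \<otimes>\<^sub>m\<^bsub>C\<^esub> Ident C y)) = \<phi> w g \<bullet>\<^bsub>C\<^esub> u)"

definition right_closed :: "('o, 'm, 'k, 'x) monoidal_data_scheme \<Rightarrow> bool" where
  "right_closed C \<longleftrightarrow> (\<forall>y \<in> Ob C. \<forall>z \<in> Ob C. \<exists>h \<phi>. is_internal_hom C y z h \<phi>)"

text \<open>
  Below, \<open>h y\<close> with \<open>\<phi> y\<close> is a chosen internal hom from \<open>x\<close> to \<open>y\<close>, for each \<open>y\<close>.
\<close>

definition ihom_ev ::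
  "('o, 'm, 'k, 'x) monoidal_data_scheme \<Rightarrow> 'o \<Rightarrow> ('o \<Rightarrow> 'o) \<Rightarrow> ('o \<Rightarrow> 'o \<Rightarrow> 'm \<Rightarrow> 'm) \<Rightarrow> 'o \<Rightarrow> 'm" where
  "ihom_ev C x h \<phi> y =
     inv_into (Hom C (h y \<otimes>\<^sub>o\<^bsub>C\<^esub> x) y) (\<phi> y (h y)) (Ident C (h y))"

definition ihom_functor ::
  "('o, 'm, 'k, 'x) monoidal_data_scheme \<Rightarrow> 'o \<Rightarrow> ('o \<Rightarrow> 'o) \<Rightarrow> ('o \<Rightarrow> 'o \<Rightarrow> 'm \<Rightarrow> 'm) \<Rightarrow>
   ('o, 'm) module_functor_data" where
  "ihom_functor C x h \<phi> =
     \<lparr>FOb = h,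
      FArr = (\<lambda>f. \<phi> (Cod C f) (h (Dom C f)) (f \<bullet>\<^bsub>C\<^esub> ihom_ev C x h \<phi> (Dom C f))),
      FCon = (\<lambda>c y. \<phi> (c \<otimes>\<^sub>o\<^bsub>C\<^esub> y) (c \<otimes>\<^sub>o\<^bsub>C\<^esub> h y)
                ((Ident C c \<otimes>\<^sub>m\<^bsub>C\<^esub> ihom_ev C x h \<phi> y) \<bullet>\<^bsub>C\<^esub> Assoc C c (h y) x))\<rparr>"


section \<open>Right duals\<close>

definition right_dual_data ::
  "('o, 'm, 'k, 'x) monoidal_data_scheme \<Rightarrow> 'o \<Rightarrow> 'o \<Rightarrow> 'm \<Rightarrow> 'm \<Rightarrow> bool" where
  "right_dual_data C x xd ev coev \<longleftrightarrow>
     ev \<in> Hom C (xd \<otimes>\<^sub>o\<^bsub>C\<^esub> x) (UnitOb C) \<and>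
     coev \<in> Hom C (UnitOb C) (x \<otimes>\<^sub>o\<^bsub>C\<^esub> xd) \<and>
     RUnit C x \<bullet>\<^bsub>C\<^esub> (Ident C x \<otimes>\<^sub>m\<^bsub>C\<^esub> ev) \<bullet>\<^bsub>C\<^esub> Assoc C x xd x \<bullet>\<^bsub>C\<^esub>
       (coev \<otimes>\<^sub>m\<^bsub>C\<^esub> Ident C x) \<bullet>\<^bsub>C\<^esub> inv_arr C (LUnit C x) = Ident C x \<and>
     LUnit C xd \<bullet>\<^bsub>C\<^esub> (ev \<otimes>\<^sub>m\<^bsub>C\<^esub> Ident C xd) \<bullet>\<^bsub>C\<^esub> inv_arr C (Assoc C xd x xd) \<bullet>\<^bsub>C\<^esub>
       (Ident C xd \<otimes>\<^sub>m\<^bsub>C\<^esub> coev) \<bullet>\<^bsub>C\<^esub> inv_arr C (RUnit C xd) = Ident C xd"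

definition is_right_dual :: "('o, 'm, 'k, 'x) monoidal_data_scheme \<Rightarrow> 'o \<Rightarrow> 'o \<Rightarrow> bool" where
  "is_right_dual C x xd \<longleftrightarrow> xd \<in> Ob C \<and> (\<exists>ev coev. right_dual_data C x xd ev coev)"

end

theory Submission
  imports Defs
begin

text \<open>
  Arrows into \<open>h y\<close> are determined by composing them, tensored with \<open>x\<close>, with the
  evaluation, so identities in the internal hom functor reduce to coherence identities. Given a
  right dual, \<open>g : w \<otimes> x \<rightarrow> y\<close> corresponds to
  \<open>w \<cong> w \<otimes> 1 \<rightarrow> w \<otimes> (x \<otimes> x\<^sup>\<or>) \<cong> (w \<otimes> x) \<otimes> x\<^sup>\<or> \<rightarrow> y \<otimes> x\<^sup>\<or>\<close>. Each
  zig-zag identity gives one of the two inversion laws of this correspondence, so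
  \<open>- \<otimes> x\<^sup>\<or>\<close> and the internal hom are right adjoints of the same functor, and the comparison
  between them respects the constraints. Conversely, if the internal hom is strong, then the
  coevaluation is the transpose \<open>1 \<rightarrow> Hom(x, x \<otimes> 1)\<close> of \<open>1 \<otimes> x \<cong> x \<otimes> 1\<close> followed by the
  inverse of the constraint \<open>x \<otimes> Hom(x, 1) \<rightarrow> Hom(x, x \<otimes> 1)\<close>.
\<close>

section \<open>Composites, inverses and cancellation in a category\<close>

context category
begin

lemma Hom_iff: "f \<in> Hom C a b \<longleftrightarrow> f \<in> Arr C \<and> Dom C f = a \<and> Cod C f = b"
  by (simp add: Hom_def)

lemma HomD [dest]:
  assumes "f \<in> Hom C a b"
  shows "f \<in> Arr C" "Dom C f = a" "Cod C f = b" "a \<in> Ob C" "b \<in> Ob C"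
  using assms Dom_closed Cod_closed by (auto simp: Hom_iff)

lemma Dom_Ob [simp]: "f \<in> Arr C \<Longrightarrow> Dom C f \<in> Ob C"
  and Cod_Ob [simp]: "f \<in> Arr C \<Longrightarrow> Cod C f \<in> Ob C"
  by (fact Dom_closed Cod_closed)+

lemma Ident_simps [simp]:
  assumes "a \<in> Ob C"
  shows "Ident C a \<in> Arr C" "Dom C (Ident C a) = a" "Cod C (Ident C a) = a"
  using Ident_closed[OF assms] by (simp_all add: Hom_iff)

text \<open>Typing conditions are phrased with \<open>Arr\<close>, \<open>Dom\<close> and
  \<open>Cod\<close>, so that they can be checked by rewriting, without guessing the intermediate
  objects that \<open>Hom\<close> would require.\<close>

lemma Comp_simps [simp]:
  assumes "f \<in> Arr C" "g \<in> Arr C" "Cod C f = Dom C g"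
  shows "g \<bullet> f \<in> Arr C" "Dom C (g \<bullet> f) = Dom C f" "Cod C (g \<bullet> f) = Cod C g"
  using Comp_closed[of f "Dom C f" "Dom C g" g "Cod C g"] assms by (simp_all add: Hom_iff)

lemma Comp_Ident [simp]:
  assumes "f \<in> Arr C"
  shows "Cod C f = b \<Longrightarrow> Ident C b \<bullet> f = f" "Dom C f = a \<Longrightarrow> f \<bullet> Ident C a = f"
  using assms Comp_Ident_left[of f "Dom C f" "Cod C f"] Comp_Ident_right[of f "Dom C f" "Cod C f"]
  by (auto simp: Hom_iff)

lemma assoc_Comp [simp]:
  assumes "f \<in> Arr C" "g \<in> Arr C" "k \<in> Arr C" "Cod C f = Dom C g" "Cod C g = Dom C k"
  shows "(k \<bullet> g) \<bullet> f = k \<bullet> (g \<bullet> f)"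
  using Comp_assoc[of f "Dom C f" "Dom C g" g "Dom C k" k "Cod C k"] assms by (simp add: Hom_iff)

text \<open>Composites are normalised by nesting to the right, and then an equation for
  \<open>k \<bullet> g\<close> no longer matches. This form applies it at the head of a longer
  composite.\<close>

lemma Comp_reassoc:
  assumes "k \<bullet> g = e" "f \<in> Arr C" "g \<in> Arr C" "k \<in> Arr C" "Cod C f = Dom C g" "Cod C g = Dom C k"
  shows "k \<bullet> (g \<bullet> f) = e \<bullet> f"
  using assms(2-) by (simp flip: assms(1))

lemma inverse_arrows_unique:
  assumes "inverse_arrows C f g" "inverse_arrows C f g'"
  shows "g = g'"
proof -
  have "g = (g' \<bullet> f) \<bullet> g"
    using assms by (auto simp: inverse_arrows_def Hom_iff)
  also have "\<dots> = g' \<bullet> (f \<bullet> g)"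
    using assms by (intro assoc_Comp) (auto simp: inverse_arrows_def Hom_iff)
  finally show ?thesis
    using assms by (auto simp: inverse_arrows_def Hom_iff)
qed

lemma inv_arr_eq: "inverse_arrows C f g \<Longrightarrow> inv_arr C f = g"
  unfolding inv_arr_def using inverse_arrows_unique by blast

lemma inverse_arrows_inv_arr: "iso_arr C f \<Longrightarrow> inverse_arrows C f (inv_arr C f)"
  using inv_arr_eq by (auto simp: iso_arr_def)

lemma iso_arr_Arr: "iso_arr C f \<Longrightarrow> f \<in> Arr C"
  by (auto simp: iso_arr_def inverse_arrows_def)

lemma inv_arr_simps [simp]:
  assumes "iso_arr C f"
  shows "inv_arr C f \<in> Arr C" "Dom C (inv_arr C f) = Cod C f" "Cod C (inv_arr C f) = Dom C f"
    "inv_arr C f \<bullet> f = Ident C (Dom C f)" "f \<bullet> inv_arr C f = Ident C (Cod C f)"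
  using inverse_arrows_inv_arr[OF assms] by (auto simp: inverse_arrows_def Hom_iff)

lemma inv_arr_reassoc [simp]:
  assumes "iso_arr C f" "g \<in> Arr C"
  shows "Cod C g = Dom C f \<Longrightarrow> inv_arr C f \<bullet> (f \<bullet> g) = g"
    "Cod C g = Cod C f \<Longrightarrow> f \<bullet> (inv_arr C f \<bullet> g) = g"
  using assms iso_arr_Arr[OF assms(1)] by (simp_all flip: assoc_Comp)

lemma iso_arrI:
  assumes "f \<in> Arr C" "g \<in> Arr C" "Dom C g = Cod C f" "Cod C g = Dom C f"
    "g \<bullet> f = Ident C (Dom C f)" "f \<bullet> g = Ident C (Cod C f)"
  shows "iso_arr C f"
  using assms by (auto simp: iso_arr_def inverse_arrows_def Hom_iff)

lemma iso_arr_inv_arr [simp]: "iso_arr C f \<Longrightarrow> iso_arr C (inv_arr C f)"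
  by (rule iso_arrI[of _ f]) (auto simp: iso_arr_Arr)

lemma iso_arr_Comp:
  assumes "iso_arr C f" "iso_arr C g" "Cod C f = Dom C g"
  shows "iso_arr C (g \<bullet> f)"
  using assms iso_arr_Arr[OF assms(1)] iso_arr_Arr[OF assms(2)]
  by (intro iso_arrI[of _ "inv_arr C f \<bullet> inv_arr C g"]) auto

lemma iso_cancel_right:
  assumes "iso_arr C e" "f \<bullet> e = g \<bullet> e" "f \<in> Arr C" "g \<in> Arr C" "Dom C f = Cod C e" "Dom C g = Cod C e"
  shows "f = g"
proof -
  have "(f \<bullet> e) \<bullet> inv_arr C e = (g \<bullet> e) \<bullet> inv_arr C e"
    using assms by simp
  thus ?thesis
    using assms(1,3-) iso_arr_Arr[OF assms(1)] by simp
qed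

lemma iso_cancel_left:
  assumes "iso_arr C e" "e \<bullet> f = e \<bullet> g" "f \<in> Arr C" "g \<in> Arr C" "Cod C f = Dom C e" "Cod C g = Dom C e"
  shows "f = g"
proof -
  have "inv_arr C e \<bullet> (e \<bullet> f) = inv_arr C e \<bullet> (e \<bullet> g)"
    using assms by simp
  thus ?thesis
    using assms(1,3-) iso_arr_Arr[OF assms(1)] by simp
qed

end

section \<open>Closure of hom spaces under the linear operations\<close>

context linear_category
begin

text \<open>\<open>ArrAdd C\<close> is the addition of the module \<open>hom_space C a b\<close>,
  whose carrier is \<open>Hom C a b\<close>, so closure is a module law.\<close>

lemma ArrAdd_closed:
  assumes "f \<in> Hom C a b" "g \<in> Hom C a b"
  shows "ArrAdd C f g \<in> Hom C a b"
proof -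
  have ab: "a \<in> Ob C" "b \<in> Ob C"
    using assms(1) by auto
  interpret module K "hom_space C a b"
    by (rule hom_space_module[OF ab])
  show ?thesis
    using M.a_closed[of f g] assms by (simp add: hom_space_def)
qed

lemma ArrScale_closed:
  assumes "k \<in> carrier K" "f \<in> Hom C a b"
  shows "ArrScale C k f \<in> Hom C a b"
proof -
  have ab: "a \<in> Ob C" "b \<in> Ob C"
    using assms(2) by auto
  interpret module K "hom_space C a b"
    by (rule hom_space_module[OF ab])
  show ?thesis
    using smult_closed[of k f] assms by (simp add: hom_space_def)
qed

end

section \<open>Whiskering, coherence of the unitors, and tensoring on the right\<close>

context linear_monoidal_category
begin

abbreviation left_whisker :: "'o \<Rightarrow> 'm \<Rightarrow> 'm" (infixr \<open>\<triangleright>\<close> 75)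
  where "c \<triangleright> f \<equiv> Ident C c \<otimes>\<^sub>m f"

abbreviation right_whisker :: "'m \<Rightarrow> 'o \<Rightarrow> 'm" (infixl \<open>\<triangleleft>\<close> 75)
  where "f \<triangleleft> c \<equiv> f \<otimes>\<^sub>m Ident C c"

lemma TensorOb_Ob [simp]: "a \<in> Ob C \<Longrightarrow> b \<in> Ob C \<Longrightarrow> a \<otimes>\<^sub>o b \<in> Ob C"
  and UnitOb_Ob [simp]: "UnitOb C \<in> Ob C"
  by (fact TensorOb_closed UnitOb_closed)+

lemma TensorArr_simps [simp]:
  assumes "f \<in> Arr C" "g \<in> Arr C"
  shows "f \<otimes>\<^sub>m g \<in> Arr C" "Dom C (f \<otimes>\<^sub>m g) = Dom C f \<otimes>\<^sub>o Dom C g"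
    "Cod C (f \<otimes>\<^sub>m g) = Cod C f \<otimes>\<^sub>o Cod C g"
  using TensorArr_closed[of f "Dom C f" "Cod C f" g "Dom C g" "Cod C g"] assms
  by (simp_all add: Hom_iff)

declare TensorArr_Ident [simp]

lemma interchange:
  assumes "f \<in> Arr C" "g \<in> Arr C" "f' \<in> Arr C" "g' \<in> Arr C" "Cod C f = Dom C g" "Cod C f' = Dom C g'"
  shows "(g \<otimes>\<^sub>m g') \<bullet> (f \<otimes>\<^sub>m f') = (g \<bullet> f) \<otimes>\<^sub>m (g' \<bullet> f')"
  using TensorArr_Comp[of f "Dom C f" "Cod C f" g "Cod C g" f' "Dom C f'" "Cod C f'" g' "Cod C g'"] assms
  by (simp add: Hom_iff)

lemma left_whisker_Comp:
  assumes "f \<in> Arr C" "g \<in> Arr C" "Cod C f = Dom C g" "c \<in> Ob C"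
  shows "c \<triangleright> (g \<bullet> f) = (c \<triangleright> g) \<bullet> (c \<triangleright> f)"
  using assms by (simp add: interchange)

lemma right_whisker_Comp:
  assumes "f \<in> Arr C" "g \<in> Arr C" "Cod C f = Dom C g" "c \<in> Ob C"
  shows "(g \<bullet> f) \<triangleleft> c = (g \<triangleleft> c) \<bullet> (f \<triangleleft> c)"
  using assms by (simp add: interchange)

text \<open>Arrows acting on different tensor factors commute: by interchange both composites equal
  \<open>f \<otimes>\<^sub>m g\<close>.\<close>

lemma whisker_exchange:
  assumes "f \<in> Arr C" "g \<in> Arr C" "Dom C f = a" "Cod C f = a'" "Dom C g = b" "Cod C g = b'"
  shows "(f \<triangleleft> b') \<bullet> (a \<triangleright> g) = (a' \<triangleright> g) \<bullet> (f \<triangleleft> b)"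
  using assms by (auto simp: interchange)

lemma iso_left_whisker:
  assumes "iso_arr C f" "c \<in> Ob C"
  shows "iso_arr C (c \<triangleright> f)" "inv_arr C (c \<triangleright> f) = c \<triangleright> inv_arr C f"
proof -
  have "inverse_arrows C (c \<triangleright> f) (c \<triangleright> inv_arr C f)"
    using assms iso_arr_Arr[OF assms(1)] by (simp add: inverse_arrows_def Hom_iff interchange)
  thus "iso_arr C (c \<triangleright> f)" "inv_arr C (c \<triangleright> f) = c \<triangleright> inv_arr C f"
    using inv_arr_eq by (auto simp: iso_arr_def)
qed

lemma iso_right_whisker:
  assumes "iso_arr C f" "c \<in> Ob C"
  shows "iso_arr C (f \<triangleleft> c)" "inv_arr C (f \<triangleleft> c) = inv_arr C f \<triangleleft> c"
proof -
  have "inverse_arrows C (f \<triangleleft> c) (inv_arr C f \<triangleleft> c)"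
    using assms iso_arr_Arr[OF assms(1)] by (simp add: inverse_arrows_def Hom_iff interchange)
  thus "iso_arr C (f \<triangleleft> c)" "inv_arr C (f \<triangleleft> c) = inv_arr C f \<triangleleft> c"
    using inv_arr_eq by (auto simp: iso_arr_def)
qed

lemma Assoc_simps [simp]:
  assumes "a \<in> Ob C" "b \<in> Ob C" "c \<in> Ob C"
  shows "Assoc C a b c \<in> Arr C" "Dom C (Assoc C a b c) = (a \<otimes>\<^sub>o b) \<otimes>\<^sub>o c"
    "Cod C (Assoc C a b c) = a \<otimes>\<^sub>o (b \<otimes>\<^sub>o c)" "iso_arr C (Assoc C a b c)"
  using Assoc_closed[OF assms] Assoc_iso[OF assms] by (simp_all add: Hom_iff)

lemma LUnit_simps [simp]:
  assumes "a \<in> Ob C"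
  shows "LUnit C a \<in> Arr C" "Dom C (LUnit C a) = UnitOb C \<otimes>\<^sub>o a" "Cod C (LUnit C a) = a"
    "iso_arr C (LUnit C a)"
  using LUnit_closed[OF assms] LUnit_iso[OF assms] by (simp_all add: Hom_iff)

lemma RUnit_simps [simp]:
  assumes "a \<in> Ob C"
  shows "RUnit C a \<in> Arr C" "Dom C (RUnit C a) = a \<otimes>\<^sub>o UnitOb C" "Cod C (RUnit C a) = a"
    "iso_arr C (RUnit C a)"
  using RUnit_closed[OF assms] RUnit_iso[OF assms] by (simp_all add: Hom_iff)

lemma Assoc_natural_left:
  assumes "f \<in> Arr C" "Dom C f = a" "Cod C f = a'" "b \<in> Ob C" "c \<in> Ob C"
  shows "Assoc C a' b c \<bullet> ((f \<triangleleft> b) \<triangleleft> c) = (f \<triangleleft> (b \<otimes>\<^sub>o c)) \<bullet> Assoc C a b c"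
  using Assoc_natural[of f a a' "Ident C b" b b "Ident C c" c c] assms by (simp add: Hom_iff)

lemma Assoc_natural_middle:
  assumes "g \<in> Arr C" "Dom C g = b" "Cod C g = b'" "a \<in> Ob C" "c \<in> Ob C"
  shows "Assoc C a b' c \<bullet> ((a \<triangleright> g) \<triangleleft> c) = (a \<triangleright> (g \<triangleleft> c)) \<bullet> Assoc C a b c"
  using Assoc_natural[of "Ident C a" a a g b b' "Ident C c" c c] assms by (simp add: Hom_iff)

lemma Assoc_natural_right:
  assumes "k \<in> Arr C" "Dom C k = c" "Cod C k = c'" "a \<in> Ob C" "b \<in> Ob C"
  shows "Assoc C a b c' \<bullet> ((a \<otimes>\<^sub>o b) \<triangleright> k) = (a \<triangleright> (b \<triangleright> k)) \<bullet> Assoc C a b c"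
  using Assoc_natural[of "Ident C a" a a "Ident C b" b b k c c'] assms by (simp add: Hom_iff)

text \<open>Naturality of the left unitor recovers \<open>f \<bullet> LUnit C a\<close> from
  \<open>UnitOb C \<triangleright> f\<close>, and the isomorphism \<open>LUnit C a\<close> can be
  cancelled.\<close>

lemma unit_left_whisker_faithful:
  assumes "UnitOb C \<triangleright> f = UnitOb C \<triangleright> g" "f \<in> Hom C a b" "g \<in> Hom C a b"
  shows "f = g"
proof (rule iso_cancel_right)
  show "f \<bullet> LUnit C a = g \<bullet> LUnit C a"
    using assms LUnit_natural by metis
qed (use HomD[OF assms(2)] HomD[OF assms(3)] in auto)

lemma unit_right_whisker_faithful:
  assumes "f \<triangleleft> UnitOb C = g \<triangleleft> UnitOb C" "f \<in> Hom C a b" "g \<in> Hom C a b"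
  shows "f = g"
proof (rule iso_cancel_right)
  show "f \<bullet> RUnit C a = g \<bullet> RUnit C a"
    using assms RUnit_natural by metis
qed (use HomD[OF assms(2)] HomD[OF assms(3)] in auto)

text \<open>
  Kelly's argument: tensoring with the unit on the left is faithful, and after that the claim
  follows from the pentagon and the triangle once composed with isomorphisms.
\<close>

lemma LUnit_TensorOb:
  assumes [simp]: "a \<in> Ob C" "b \<in> Ob C"
  shows "LUnit C (a \<otimes>\<^sub>o b) \<bullet> Assoc C (UnitOb C) a b = LUnit C a \<triangleleft> b"
proof (rule unit_left_whisker_faithful)
  let ?u = "UnitOb C"
  \<comment> \<open>\<open>?A \<bullet> ?B\<close> is the tail of the pentagon for
    \<open>?u\<close>, \<open>?u\<close>, \<open>a\<close>, \<open>b\<close>. Precomposing with it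
    makes the pentagon applicable.\<close>
  let ?A = "Assoc C ?u (?u \<otimes>\<^sub>o a) b" and ?B = "Assoc C ?u ?u a \<triangleleft> b"
  show "?u \<triangleright> (LUnit C (a \<otimes>\<^sub>o b) \<bullet> Assoc C ?u a b) = ?u \<triangleright> (LUnit C a \<triangleleft> b)"
  proof (rule iso_cancel_right)
    show "iso_arr C (?A \<bullet> ?B)"
      by (intro iso_arr_Comp) (simp_all add: iso_right_whisker)
    have "(?u \<triangleright> (LUnit C (a \<otimes>\<^sub>o b) \<bullet> Assoc C ?u a b)) \<bullet> (?A \<bullet> ?B)
        = (?u \<triangleright> LUnit C (a \<otimes>\<^sub>o b)) \<bullet> (?u \<triangleright> Assoc C ?u a b) \<bullet> ?A \<bullet> ?B"
      by (simp add: left_whisker_Comp)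
    also have "\<dots> = (?u \<triangleright> LUnit C (a \<otimes>\<^sub>o b)) \<bullet> Assoc C ?u ?u (a \<otimes>\<^sub>o b) \<bullet> Assoc C (?u \<otimes>\<^sub>o ?u) a b"
      by (simp add: pentagon)
    also have "\<dots> = (RUnit C ?u \<triangleleft> (a \<otimes>\<^sub>o b)) \<bullet> Assoc C (?u \<otimes>\<^sub>o ?u) a b"
      by (rule Comp_reassoc) (simp_all add: triangle)
    also have "\<dots> = Assoc C ?u a b \<bullet> ((RUnit C ?u \<triangleleft> a) \<triangleleft> b)"
      by (simp add: Assoc_natural_left)
    also have "\<dots> = Assoc C ?u a b \<bullet> ((?u \<triangleright> LUnit C a) \<triangleleft> b) \<bullet> ?B"
      by (simp add: right_whisker_Comp flip: triangle)
    also have "\<dots> = ((?u \<triangleright> (LUnit C a \<triangleleft> b)) \<bullet> ?A) \<bullet> ?B"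
      by (rule Comp_reassoc) (simp_all add: Assoc_natural_middle)
    finally show "(?u \<triangleright> (LUnit C (a \<otimes>\<^sub>o b) \<bullet> Assoc C ?u a b)) \<bullet> (?A \<bullet> ?B)
      = (?u \<triangleright> (LUnit C a \<triangleleft> b)) \<bullet> (?A \<bullet> ?B)"
      by simp
  qed simp_all
qed (auto simp: Hom_iff)

text \<open>Mirror image of the previous argument: whiskering by the unit on the right is faithful,
  and postcomposing with the associator \<open>?A\<close> lets the pentagon for \<open>a\<close>,
  \<open>b\<close> and two units combine with the triangle.\<close>

lemma RUnit_TensorOb:
  assumes [simp]: "a \<in> Ob C" "b \<in> Ob C"
  shows "(a \<triangleright> RUnit C b) \<bullet> Assoc C a b (UnitOb C) = RUnit C (a \<otimes>\<^sub>o b)"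
proof (rule unit_right_whisker_faithful)
  let ?u = "UnitOb C"
  let ?A = "Assoc C a b ?u"
  show "((a \<triangleright> RUnit C b) \<bullet> ?A) \<triangleleft> ?u = RUnit C (a \<otimes>\<^sub>o b) \<triangleleft> ?u"
  proof (rule iso_cancel_left)
    have "?A \<bullet> (((a \<triangleright> RUnit C b) \<bullet> ?A) \<triangleleft> ?u) = ?A \<bullet> ((a \<triangleright> RUnit C b) \<triangleleft> ?u) \<bullet> (?A \<triangleleft> ?u)"
      by (simp add: right_whisker_Comp)
    also have "\<dots> = ((a \<triangleright> (RUnit C b \<triangleleft> ?u)) \<bullet> Assoc C a (b \<otimes>\<^sub>o ?u) ?u) \<bullet> (?A \<triangleleft> ?u)"
      by (rule Comp_reassoc) (simp_all add: Assoc_natural_middle)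
    also have "\<dots> = (a \<triangleright> (b \<triangleright> LUnit C ?u)) \<bullet> (a \<triangleright> Assoc C b ?u ?u) \<bullet> Assoc C a (b \<otimes>\<^sub>o ?u) ?u \<bullet> (?A \<triangleleft> ?u)"
      by (simp add: left_whisker_Comp flip: triangle)
    also have "\<dots> = (a \<triangleright> (b \<triangleright> LUnit C ?u)) \<bullet> Assoc C a b (?u \<otimes>\<^sub>o ?u) \<bullet> Assoc C (a \<otimes>\<^sub>o b) ?u ?u"
      by (simp add: pentagon)
    also have "\<dots> = ((a \<triangleright> (b \<triangleright> LUnit C ?u)) \<bullet> Assoc C a b (?u \<otimes>\<^sub>o ?u)) \<bullet> Assoc C (a \<otimes>\<^sub>o b) ?u ?u"
      by simp
    also have "\<dots> = (?A \<bullet> ((a \<otimes>\<^sub>o b) \<triangleright> LUnit C ?u)) \<bullet> Assoc C (a \<otimes>\<^sub>o b) ?u ?u"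
      by (subst Assoc_natural_right[where c = "?u \<otimes>\<^sub>o ?u"]) simp_all
    also have "\<dots> = ?A \<bullet> (RUnit C (a \<otimes>\<^sub>o b) \<triangleleft> ?u)"
      by (simp add: triangle del: TensorArr_Ident)
    finally show "?A \<bullet> (((a \<triangleright> RUnit C b) \<bullet> ?A) \<triangleleft> ?u) = ?A \<bullet> (RUnit C (a \<otimes>\<^sub>o b) \<triangleleft> ?u)" .
  qed simp_all
qed (auto simp: Hom_iff)

text \<open>Naturality of the left unitor at itself identifies \<open>LUnit\<close> of unit tensor
  unit with the left whiskering of \<open>LUnit\<close> at the unit. \<open>LUnit_TensorOb\<close>
  and the triangle then give the same right whiskering for both unitors.\<close>

lemma LUnit_UnitOb: "LUnit C (UnitOb C) = RUnit C (UnitOb C)"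
proof (rule unit_right_whisker_faithful)
  let ?u = "UnitOb C"
  have "?u \<triangleright> LUnit C ?u = LUnit C (?u \<otimes>\<^sub>o ?u)"
    using LUnit_natural[OF LUnit_closed[of ?u]] by (auto intro: iso_cancel_left[of "LUnit C ?u"])
  thus "LUnit C ?u \<triangleleft> ?u = RUnit C ?u \<triangleleft> ?u"
    using LUnit_TensorOb[of ?u ?u] triangle[of ?u ?u] by simp
qed (auto simp: Hom_iff)

text \<open>The constraint is an inverse associator, so each law is an inverted associator law:
  naturality, the pentagon, and \<open>LUnit_TensorOb\<close> for the unit.\<close>

lemma strong_tensor_right_functor:
  assumes [simp]: "z \<in> Ob C"
  shows "strong_module_functor K C (tensor_right_functor C z)"
proof -
  let ?T = "tensor_right_functor C z"
  have lin: "linear_endofunctor K C (FOb ?T) (FArr ?T)"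
    using TensorArr_add_left[OF _ _ Ident_closed[OF assms]]
      TensorArr_scale_left[OF _ _ Ident_closed[OF assms]]
    by (auto simp: linear_endofunctor_def tensor_right_functor_def Hom_iff right_whisker_Comp)
  have nat: "FArr ?T (f \<otimes>\<^sub>m g) \<bullet> FCon ?T c y = FCon ?T c' y' \<bullet> (f \<otimes>\<^sub>m FArr ?T g)"
    if "f \<in> Hom C c c'" "g \<in> Hom C y y'" for c c' y y' f g
  proof -
    have [simp]: "f \<in> Arr C" "g \<in> Arr C" "Dom C f = c" "Cod C f = c'" "Dom C g = y" "Cod C g = y'"
      "c \<in> Ob C" "c' \<in> Ob C" "y \<in> Ob C" "y' \<in> Ob C"
      using that by auto
    let ?l = "(f \<otimes>\<^sub>m g) \<triangleleft> z" and ?r = "f \<otimes>\<^sub>m (g \<triangleleft> z)"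
    let ?A = "Assoc C c y z" and ?B = "Assoc C c' y' z"
    have "?B \<bullet> ?l = ?r \<bullet> ?A"
      by (rule Assoc_natural) (simp_all add: Hom_iff)
    hence "inv_arr C ?B \<bullet> (?B \<bullet> ?l) \<bullet> inv_arr C ?A = inv_arr C ?B \<bullet> (?r \<bullet> ?A) \<bullet> inv_arr C ?A"
      by simp
    thus ?thesis
      by (simp add: tensor_right_functor_def)
  qed
  have coh: "FArr ?T (Assoc C c d y) \<bullet> FCon ?T (c \<otimes>\<^sub>o d) y =
      FCon ?T c (d \<otimes>\<^sub>o y) \<bullet> (c \<triangleright> FCon ?T d y) \<bullet> Assoc C c d (FOb ?T y)"
    if [simp]: "c \<in> Ob C" "d \<in> Ob C" "y \<in> Ob C" for c d y
  proof -
    let ?A = "Assoc C (c \<otimes>\<^sub>o d) y z" and ?B = "Assoc C c (d \<otimes>\<^sub>o y) z" and ?D = "c \<triangleright> Assoc C d y z"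
    have D: "iso_arr C ?D" "inv_arr C ?D = c \<triangleright> inv_arr C (Assoc C d y z)"
      by (simp_all add: iso_left_whisker)
    \<comment> \<open>The pentagon with \<open>?D\<close> and \<open>?B\<close> cancelled on the
      left and \<open>?A\<close> cancelled on the right is exactly the coherence law.\<close>
    have "inv_arr C ?B \<bullet> inv_arr C ?D \<bullet> (Assoc C c d (y \<otimes>\<^sub>o z) \<bullet> ?A) \<bullet> inv_arr C ?A
      = inv_arr C ?B \<bullet> inv_arr C ?D \<bullet> (?D \<bullet> ?B \<bullet> (Assoc C c d y \<triangleleft> z)) \<bullet> inv_arr C ?A"
      by (simp only: pentagon that assms)
    thus ?thesis
      using D(1) by (simp add: tensor_right_functor_def flip: D(2))
  qed
  have unit: "FArr ?T (LUnit C y) \<bullet> FCon ?T (UnitOb C) y = LUnit C (FOb ?T y)"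
    if [simp]: "y \<in> Ob C" for y
    by (simp add: tensor_right_functor_def flip: LUnit_TensorOb)
  show ?thesis
    unfolding strong_module_functor_def lax_module_functor_def
    using lin nat coh unit by (auto simp: tensor_right_functor_def Hom_iff)
qed

end

section \<open>Moving inverse arrows across equations\<close>

context category
begin

text \<open>Composing the square with the two inverses reverses its invertible sides. This passes
  naturality from associators, unitors and comparison maps to their inverses.\<close>

lemma inv_arr_square:
  assumes "e' \<bullet> f = g \<bullet> e" "iso_arr C e" "iso_arr C e'" "f \<in> Arr C" "g \<in> Arr C"
    "Dom C f = Dom C e" "Cod C f = Dom C e'" "Dom C g = Cod C e" "Cod C g = Cod C e'"
  shows "inv_arr C e' \<bullet> g = f \<bullet> inv_arr C e"
proof -
  have [simp]: "e \<in> Arr C" "e' \<in> Arr C"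
    using assms iso_arr_Arr by auto
  have "inv_arr C e' \<bullet> g = inv_arr C e' \<bullet> (g \<bullet> e) \<bullet> inv_arr C e"
    using assms(2-) by simp
  also have "\<dots> = f \<bullet> inv_arr C e"
    using assms(2-) by (simp flip: assms(1))
  finally show ?thesis .
qed

text \<open>Serves to remove the inverse unitor at the end of a zig-zag composite.\<close>

lemma Comp_inv_arr_eq_Ident_iff:
  assumes "iso_arr C e" "f \<in> Arr C" "Dom C f = Dom C e"
  shows "f \<bullet> inv_arr C e = Ident C (Cod C e) \<longleftrightarrow> f = e"
proof
  have [simp]: "e \<in> Arr C"
    using assms iso_arr_Arr by auto
  assume "f \<bullet> inv_arr C e = Ident C (Cod C e)"
  hence "(f \<bullet> inv_arr C e) \<bullet> e = Ident C (Cod C e) \<bullet> e"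
    by simp
  thus "f = e"
    using assms by simp
qed (use assms in simp)

end

section \<open>Transport along isomorphisms of module functors\<close>

context linear_monoidal_category
begin

text \<open>The comparison is constructed from the tensor functor to the internal hom, whereas the
  theorem states the isomorphism in the opposite direction. Naturality and compatibility of the
  inverse come from \<open>inv_arr_square\<close>.\<close>

lemma module_functor_iso_inverse:
  assumes "lax_module_functor K C F" "lax_module_functor K C G" "module_functor_iso C F G \<theta>"
  shows "module_functor_iso C G F (\<lambda>y. inv_arr C (\<theta> y))"
  unfolding module_functor_iso_def
proof (intro conjI ballI allI impI)
  have F: "FOb F y \<in> Ob C" and G: "FOb G y \<in> Ob C" if "y \<in> Ob C" for y
    using assms that by (auto simp: lax_module_functor_def linear_endofunctor_def)
  have \<theta>: "\<theta> y \<in> Hom C (FOb F y) (FOb G y)" "iso_arr C (\<theta> y)" if "y \<in> Ob C" for y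
    using assms that by (auto simp: module_functor_iso_def)
  show "inv_arr C (\<theta> y) \<in> Hom C (FOb G y) (FOb F y)" "iso_arr C (inv_arr C (\<theta> y))" if "y \<in> Ob C" for y
    using \<theta>[OF that] by (auto simp: Hom_iff)
  show "FArr F f \<bullet> inv_arr C (\<theta> y) = inv_arr C (\<theta> z) \<bullet> FArr G f" if "f \<in> Hom C y z" for y z f
  proof -
    have "FArr F f \<in> Hom C (FOb F y) (FOb F z)" "FArr G f \<in> Hom C (FOb G y) (FOb G z)"
      using assms that by (auto simp: lax_module_functor_def linear_endofunctor_def)
    moreover have "\<theta> z \<bullet> FArr F f = FArr G f \<bullet> \<theta> y"
      using assms that by (auto simp: module_functor_iso_def)
    ultimately show ?thesis
      using \<theta>[of y] \<theta>[of z] HomD[OF that] by (intro inv_arr_square[symmetric]) (auto simp: Hom_iff)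
  qed
  show "inv_arr C (\<theta> (c \<otimes>\<^sub>o y)) \<bullet> FCon G c y = FCon F c y \<bullet> (c \<triangleright> inv_arr C (\<theta> y))"
    if cy: "c \<in> Ob C" "y \<in> Ob C" for c y
  proof -
    have "FCon F c y \<in> Hom C (c \<otimes>\<^sub>o FOb F y) (FOb F (c \<otimes>\<^sub>o y))"
      "FCon G c y \<in> Hom C (c \<otimes>\<^sub>o FOb G y) (FOb G (c \<otimes>\<^sub>o y))"
      using assms cy by (auto simp: lax_module_functor_def)
    moreover have "\<theta> (c \<otimes>\<^sub>o y) \<bullet> FCon F c y = FCon G c y \<bullet> (c \<triangleright> \<theta> y)"
      using assms cy by (auto simp: module_functor_iso_def)
    ultimately have "inv_arr C (\<theta> (c \<otimes>\<^sub>o y)) \<bullet> FCon G c y = FCon F c y \<bullet> inv_arr C (c \<triangleright> \<theta> y)"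
      using \<theta>[of y] \<theta>[of "c \<otimes>\<^sub>o y"] cy F G
      by (intro inv_arr_square) (auto simp: Hom_iff iso_left_whisker)
    thus ?thesis
      using \<theta>[of y] cy by (simp add: iso_left_whisker)
  qed
qed

text \<open>Compatibility of \<open>\<theta>\<close> with the constraints writes
  \<open>FCon G c y\<close> as a composite of the invertible \<open>FCon F c y\<close> with a
  component of \<open>\<theta>\<close> and the inverse of a whiskered one.\<close>

lemma strong_module_functor_iso:
  assumes F: "strong_module_functor K C F" and G: "lax_module_functor K C G"
    and iso: "module_functor_iso C F G \<theta>"
  shows "strong_module_functor K C G"
proof -
  have "iso_arr C (FCon G c y)" if cy [simp]: "c \<in> Ob C" "y \<in> Ob C" for c y
  proof -
    have \<theta>: "\<theta> z \<in> Hom C (FOb F z) (FOb G z)" "iso_arr C (\<theta> z)" if "z \<in> Ob C" for z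
      using iso that by (auto simp: module_functor_iso_def)
    have con: "FCon F c y \<in> Hom C (c \<otimes>\<^sub>o FOb F y) (FOb F (c \<otimes>\<^sub>o y))" "iso_arr C (FCon F c y)"
      "FCon G c y \<in> Hom C (c \<otimes>\<^sub>o FOb G y) (FOb G (c \<otimes>\<^sub>o y))"
      using F G by (auto simp: lax_module_functor_def strong_module_functor_def)
    have w: "c \<triangleright> \<theta> y \<in> Hom C (c \<otimes>\<^sub>o FOb F y) (c \<otimes>\<^sub>o FOb G y)" "iso_arr C (c \<triangleright> \<theta> y)"
      using \<theta>[of y] by (auto simp: Hom_iff iso_left_whisker)
    have sq: "\<theta> (c \<otimes>\<^sub>o y) \<bullet> FCon F c y = FCon G c y \<bullet> (c \<triangleright> \<theta> y)"
      using iso by (auto simp: module_functor_iso_def)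
    have "FCon G c y = (FCon G c y \<bullet> (c \<triangleright> \<theta> y)) \<bullet> inv_arr C (c \<triangleright> \<theta> y)"
      using con w by (auto simp: Hom_iff)
    also have "\<dots> = (\<theta> (c \<otimes>\<^sub>o y) \<bullet> FCon F c y) \<bullet> inv_arr C (c \<triangleright> \<theta> y)"
      by (simp only: sq)
    finally have "FCon G c y = (\<theta> (c \<otimes>\<^sub>o y) \<bullet> FCon F c y) \<bullet> inv_arr C (c \<triangleright> \<theta> y)" .
    moreover have "iso_arr C \<dots>"
      using con w \<theta>[of "c \<otimes>\<^sub>o y"] by (intro iso_arr_Comp iso_arr_inv_arr) (auto simp: Hom_iff)
    ultimately show ?thesis
      by simp
  qed
  thus ?thesis
    using G by (simp add: strong_module_functor_def)
qed

text \<open>Moving the inverse unitors to the other side gives the zig-zag identities in the form in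
  which they are proved and applied below.\<close>

lemma right_dual_data_iff:
  assumes [simp]: "x \<in> Ob C" "xd \<in> Ob C"
  shows "right_dual_data C x xd e k \<longleftrightarrow>
    e \<in> Hom C (xd \<otimes>\<^sub>o x) (UnitOb C) \<and> k \<in> Hom C (UnitOb C) (x \<otimes>\<^sub>o xd) \<and>
    RUnit C x \<bullet> (x \<triangleright> e) \<bullet> Assoc C x xd x \<bullet> (k \<triangleleft> x) = LUnit C x \<and>
    LUnit C xd \<bullet> (e \<triangleleft> xd) \<bullet> inv_arr C (Assoc C xd x xd) \<bullet> (xd \<triangleright> k) = RUnit C xd"
  (is "_ \<longleftrightarrow> ?rhs")
proof (cases "e \<in> Hom C (xd \<otimes>\<^sub>o x) (UnitOb C) \<and> k \<in> Hom C (UnitOb C) (x \<otimes>\<^sub>o xd)")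
  case True
  hence [simp]: "e \<in> Arr C" "Dom C e = xd \<otimes>\<^sub>o x" "Cod C e = UnitOb C"
    "k \<in> Arr C" "Dom C k = UnitOb C" "Cod C k = x \<otimes>\<^sub>o xd"
    by auto
  show ?thesis
    using True
      Comp_inv_arr_eq_Ident_iff[of "LUnit C x" "RUnit C x \<bullet> (x \<triangleright> e) \<bullet> Assoc C x xd x \<bullet> (k \<triangleleft> x)"]
      Comp_inv_arr_eq_Ident_iff[of "RUnit C xd"
        "LUnit C xd \<bullet> (e \<triangleleft> xd) \<bullet> inv_arr C (Assoc C xd x xd) \<bullet> (xd \<triangleright> k)"]
    by (simp add: right_dual_data_def)
qed (auto simp: right_dual_data_def)

section \<open>Transposition along a candidate evaluation and coevaluation\<close>

definition dual_curry :: "'o \<Rightarrow> 'o \<Rightarrow> 'm \<Rightarrow> 'o \<Rightarrow> 'm \<Rightarrow> 'm"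
  where "dual_curry x xd k w g =
    (g \<triangleleft> xd) \<bullet> inv_arr C (Assoc C w x xd) \<bullet> (w \<triangleright> k) \<bullet> inv_arr C (RUnit C w)"

text \<open>The counit at \<open>y\<close> of the intended adjunction between tensoring with
  \<open>x\<close> and tensoring with \<open>xd\<close>. It is built from the evaluation alone, as
  \<open>dual_curry\<close> is built from the coevaluation alone.\<close>

definition dual_counit :: "'o \<Rightarrow> 'o \<Rightarrow> 'm \<Rightarrow> 'o \<Rightarrow> 'm"
  where "dual_counit x xd e y = RUnit C y \<bullet> (y \<triangleright> e) \<bullet> Assoc C y xd x"

end

text \<open>The zig-zag identities are kept out of the locale: each inversion law below takes one of
  them as a premise, and the converse direction uses the first to derive the second.\<close>

locale dual_pair = linear_monoidal_category K C
  for K :: "('k, 'r) ring_scheme" and C :: "('o, 'm, 'k, 'x) monoidal_data_scheme" (structure) +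
  fixes x xd e k
  assumes x_Ob [simp]: "x \<in> Ob C" and xd_Ob [simp]: "xd \<in> Ob C"
    and e_Hom: "e \<in> Hom C (xd \<otimes>\<^sub>o x) (UnitOb C)"
    and k_Hom: "k \<in> Hom C (UnitOb C) (x \<otimes>\<^sub>o xd)"
begin

abbreviation curry where "curry \<equiv> dual_curry x xd k"
abbreviation counit where "counit \<equiv> dual_counit x xd e"

lemma e_simps [simp]: "e \<in> Arr C" "Dom C e = xd \<otimes>\<^sub>o x" "Cod C e = UnitOb C"
  and k_simps [simp]: "k \<in> Arr C" "Dom C k = UnitOb C" "Cod C k = x \<otimes>\<^sub>o xd"
  using e_Hom k_Hom by auto

lemma counit_simps [simp]:
  assumes "y \<in> Ob C"
  shows "counit y \<in> Arr C" "Dom C (counit y) = (y \<otimes>\<^sub>o xd) \<otimes>\<^sub>o x" "Cod C (counit y) = y"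
  using assms by (simp_all add: dual_counit_def)

lemma curry_simps [simp]:
  assumes "g \<in> Arr C" "w \<in> Ob C" "Dom C g = w \<otimes>\<^sub>o x"
  shows "curry w g \<in> Arr C" "Dom C (curry w g) = w" "Cod C (curry w g) = Cod C g \<otimes>\<^sub>o xd"
  using assms by (simp_all add: dual_curry_def)

text \<open>The arrow \<open>f\<close> passes the associator by naturality, passes \<open>e\<close>
  because they act on different factors, and passes the right unitor by naturality.\<close>

lemma counit_natural:
  assumes f [simp]: "f \<in> Arr C" "Dom C f = y" "Cod C f = z"
  shows "counit z \<bullet> ((f \<triangleleft> xd) \<triangleleft> x) = f \<bullet> counit y"
proof -
  have [simp]: "y \<in> Ob C" "z \<in> Ob C"
    using Dom_Ob[OF f(1)] Cod_Ob[OF f(1)] by simp_all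
  have "counit z \<bullet> ((f \<triangleleft> xd) \<triangleleft> x) = RUnit C z \<bullet> (z \<triangleright> e) \<bullet> (f \<triangleleft> (xd \<otimes>\<^sub>o x)) \<bullet> Assoc C y xd x"
    by (simp add: dual_counit_def Assoc_natural_left del: TensorArr_Ident)
  also have "\<dots> = RUnit C z \<bullet> ((z \<triangleright> e) \<bullet> (f \<triangleleft> (xd \<otimes>\<^sub>o x))) \<bullet> Assoc C y xd x"
    by simp
  also have "\<dots> = RUnit C z \<bullet> ((f \<triangleleft> UnitOb C) \<bullet> (y \<triangleright> e)) \<bullet> Assoc C y xd x"
    by (simp add: interchange)
  also have "\<dots> = (RUnit C z \<bullet> (f \<triangleleft> UnitOb C)) \<bullet> (y \<triangleright> e) \<bullet> Assoc C y xd x"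
    by simp
  also have "\<dots> = f \<bullet> counit y"
    using RUnit_natural[of f y z] by (simp add: dual_counit_def Hom_iff)
  finally show ?thesis .
qed

text \<open>The counit is a module transformation. The pentagon gathers the associators, naturality
  moves \<open>e\<close> past them, and \<open>RUnit_TensorOb\<close> handles the unitor.\<close>

lemma counit_TensorOb:
  assumes [simp]: "c \<in> Ob C" "y \<in> Ob C"
  shows "(c \<triangleright> counit y) \<bullet> Assoc C c (y \<otimes>\<^sub>o xd) x \<bullet> (Assoc C c y xd \<triangleleft> x) = counit (c \<otimes>\<^sub>o y)"
proof -
  have "(c \<triangleright> counit y) \<bullet> Assoc C c (y \<otimes>\<^sub>o xd) x \<bullet> (Assoc C c y xd \<triangleleft> x)
      = (c \<triangleright> RUnit C y) \<bullet> (c \<triangleright> (y \<triangleright> e)) \<bullet> (c \<triangleright> Assoc C y xd x) \<bullet> Assoc C c (y \<otimes>\<^sub>o xd) x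
          \<bullet> (Assoc C c y xd \<triangleleft> x)"
    by (simp add: dual_counit_def left_whisker_Comp)
  also have "\<dots> = (c \<triangleright> RUnit C y) \<bullet> ((c \<triangleright> (y \<triangleright> e)) \<bullet> Assoc C c y (xd \<otimes>\<^sub>o x)) \<bullet> Assoc C (c \<otimes>\<^sub>o y) xd x"
    by (simp add: pentagon)
  also have "(c \<triangleright> (y \<triangleright> e)) \<bullet> Assoc C c y (xd \<otimes>\<^sub>o x) = Assoc C c y (UnitOb C) \<bullet> ((c \<otimes>\<^sub>o y) \<triangleright> e)"
    by (rule Assoc_natural_right[symmetric]) simp_all
  also have "(c \<triangleright> RUnit C y) \<bullet> (Assoc C c y (UnitOb C) \<bullet> ((c \<otimes>\<^sub>o y) \<triangleright> e)) \<bullet> Assoc C (c \<otimes>\<^sub>o y) xd x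
      = counit (c \<otimes>\<^sub>o y)"
    by (simp add: dual_counit_def flip: RUnit_TensorOb)
  finally show ?thesis .
qed

text \<open>The inverse associator and inverse unitor are natural in \<open>w\<close>, and
  \<open>u\<close> commutes with \<open>k\<close> because they act on different tensor
  factors.\<close>

lemma curry_natural:
  assumes g [simp]: "g \<in> Arr C" "Dom C g = w \<otimes>\<^sub>o x" and u [simp]: "u \<in> Arr C" "Dom C u = w'" "Cod C u = w"
  shows "curry w' (g \<bullet> (u \<triangleleft> x)) = curry w g \<bullet> u"
proof -
  let ?u = "UnitOb C"
  have [simp]: "w \<in> Ob C" "w' \<in> Ob C"
    using Dom_Ob[OF u(1)] Cod_Ob[OF u(1)] by simp_all
  have 1: "inv_arr C (Assoc C w x xd) \<bullet> (u \<triangleleft> (x \<otimes>\<^sub>o xd)) = ((u \<triangleleft> x) \<triangleleft> xd) \<bullet> inv_arr C (Assoc C w' x xd)"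
    by (rule inv_arr_square) (simp_all add: Assoc_natural_left del: TensorArr_Ident)
  have 2: "inv_arr C (RUnit C w) \<bullet> u = (u \<triangleleft> ?u) \<bullet> inv_arr C (RUnit C w')"
    by (rule inv_arr_square) (use RUnit_natural[of u w' w] in \<open>simp_all add: Hom_iff\<close>)
  have "curry w g \<bullet> u = (g \<triangleleft> xd) \<bullet> inv_arr C (Assoc C w x xd) \<bullet> ((w \<triangleright> k) \<bullet> (u \<triangleleft> ?u)) \<bullet> inv_arr C (RUnit C w')"
    by (simp add: dual_curry_def 2)
  also have "\<dots> = (g \<triangleleft> xd) \<bullet> (inv_arr C (Assoc C w x xd) \<bullet> (u \<triangleleft> (x \<otimes>\<^sub>o xd))) \<bullet> (w' \<triangleright> k) \<bullet> inv_arr C (RUnit C w')"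
    by (subst whisker_exchange[where b' = "x \<otimes>\<^sub>o xd" and a = w', symmetric]) simp_all
  also have "\<dots> = curry w' (g \<bullet> (u \<triangleleft> x))"
    by (simp add: 1 dual_curry_def right_whisker_Comp)
  finally show ?thesis ..
qed

text \<open>The first zig-zag identity makes the counit undo \<open>curry\<close>.\<close>

lemma counit_curry:
  assumes z: "RUnit C x \<bullet> (x \<triangleright> e) \<bullet> Assoc C x xd x \<bullet> (k \<triangleleft> x) = LUnit C x"
    and g [simp]: "g \<in> Arr C" "Dom C g = w \<otimes>\<^sub>o x" "Cod C g = y" and w [simp]: "w \<in> Ob C"
  shows "counit y \<bullet> (curry w g \<triangleleft> x) = g"
proof -
  let ?u = "UnitOb C"
  let ?A = "Assoc C w x xd \<triangleleft> x"
  have [simp]: "y \<in> Ob C"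
    using Cod_Ob[OF g(1)] by simp
  have A: "iso_arr C ?A" "inv_arr C ?A = inv_arr C (Assoc C w x xd) \<triangleleft> x"
    by (simp_all add: iso_right_whisker)
  have R: "iso_arr C (RUnit C w \<triangleleft> x)" "inv_arr C (RUnit C w \<triangleleft> x) = inv_arr C (RUnit C w) \<triangleleft> x"
    by (simp_all add: iso_right_whisker)
  \<comment> \<open>This is in essence the case where \<open>g\<close> is the identity of
    \<open>w \<otimes> x\<close>. A general \<open>g\<close> is then pulled out by naturality of the
    counit.\<close>
  have "counit (w \<otimes>\<^sub>o x) \<bullet> inv_arr C ?A \<bullet> ((w \<triangleright> k) \<triangleleft> x)
      = (w \<triangleright> counit x) \<bullet> Assoc C w (x \<otimes>\<^sub>o xd) x \<bullet> ((w \<triangleright> k) \<triangleleft> x)"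
    using A(1) by (simp flip: counit_TensorOb)
  also have "\<dots> = (w \<triangleright> counit x) \<bullet> (w \<triangleright> (k \<triangleleft> x)) \<bullet> Assoc C w ?u x"
    by (simp add: Assoc_natural_middle)
  \<comment> \<open>Inside the whiskering by \<open>w\<close> stands the first zig-zag composite,
    equal to \<open>LUnit C x\<close>. The triangle turns it into the right unitor of
    \<open>w\<close>.\<close>
  also have "\<dots> = (w \<triangleright> (counit x \<bullet> (k \<triangleleft> x))) \<bullet> Assoc C w ?u x"
    by (simp add: left_whisker_Comp)
  also have "\<dots> = RUnit C w \<triangleleft> x"
    by (simp add: dual_counit_def z triangle)
  finally have "counit (w \<otimes>\<^sub>o x) \<bullet> inv_arr C ?A \<bullet> ((w \<triangleright> k) \<triangleleft> x) = RUnit C w \<triangleleft> x" .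
  hence *: "g \<bullet> (counit (w \<otimes>\<^sub>o x) \<bullet> inv_arr C ?A \<bullet> ((w \<triangleright> k) \<triangleleft> x)) \<bullet> (inv_arr C (RUnit C w) \<triangleleft> x) = g"
    using R(1) by (simp flip: R(2))
  have "counit y \<bullet> (curry w g \<triangleleft> x) = (counit y \<bullet> ((g \<triangleleft> xd) \<triangleleft> x)) \<bullet> inv_arr C ?A \<bullet> ((w \<triangleright> k) \<triangleleft> x)
      \<bullet> (inv_arr C (RUnit C w) \<triangleleft> x)"
    by (simp add: dual_curry_def right_whisker_Comp A(2))
  also have "\<dots> = g"
    using A(1) * by (simp add: counit_natural)
  finally show ?thesis .
qed

text \<open>The second zig-zag identity gives the other inversion law. The associators are
  rearranged until \<open>e\<close> and \<open>k\<close> both stand inside a whiskering by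
  \<open>y\<close>, where the identity applies.\<close>

lemma curry_counit:
  assumes z: "LUnit C xd \<bullet> (e \<triangleleft> xd) \<bullet> inv_arr C (Assoc C xd x xd) \<bullet> (xd \<triangleright> k) = RUnit C xd"
    and y [simp]: "y \<in> Ob C"
  shows "curry (y \<otimes>\<^sub>o xd) (counit y) = Ident C (y \<otimes>\<^sub>o xd)"
proof -
  let ?u = "UnitOb C"
  let ?A = "Assoc C y xd x \<triangleleft> xd" and ?B = "y \<triangleright> Assoc C xd x xd"
  have B: "iso_arr C ?B" "inv_arr C ?B = y \<triangleright> inv_arr C (Assoc C xd x xd)"
    by (simp_all add: iso_left_whisker)
  let ?P = "Assoc C y xd (x \<otimes>\<^sub>o xd)" and ?Q = "Assoc C (y \<otimes>\<^sub>o xd) x xd" and ?S = "Assoc C y (xd \<otimes>\<^sub>o x) xd"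
  have tri: "(RUnit C y \<triangleleft> xd) = (y \<triangleright> LUnit C xd) \<bullet> Assoc C y ?u xd"
    by (simp add: triangle)
  \<comment> \<open>The pentagon solved for the two associators that separate \<open>e\<close> from
    \<open>k\<close> in the curried counit.\<close>
  have pent: "?A \<bullet> inv_arr C ?Q = inv_arr C ?S \<bullet> inv_arr C ?B \<bullet> ?P"
  proof -
    have "inv_arr C ?S \<bullet> inv_arr C ?B \<bullet> (?P \<bullet> ?Q) \<bullet> inv_arr C ?Q
      = inv_arr C ?S \<bullet> inv_arr C ?B \<bullet> (?B \<bullet> ?S \<bullet> ?A) \<bullet> inv_arr C ?Q"
      by (simp only: pentagon y xd_Ob x_Ob)
    thus ?thesis
      using B(1) by simp
  qed
  have eS: "Assoc C y ?u xd \<bullet> ((y \<triangleright> e) \<triangleleft> xd) \<bullet> inv_arr C ?S = y \<triangleright> (e \<triangleleft> xd)"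
  proof -
    have "(Assoc C y ?u xd \<bullet> ((y \<triangleright> e) \<triangleleft> xd)) \<bullet> inv_arr C ?S = y \<triangleright> (e \<triangleleft> xd)"
      by (subst Assoc_natural_middle[where b = "xd \<otimes>\<^sub>o x"]) simp_all
    thus ?thesis
      by simp
  qed
  have kP: "?P \<bullet> ((y \<otimes>\<^sub>o xd) \<triangleright> k) = (y \<triangleright> (xd \<triangleright> k)) \<bullet> Assoc C y xd ?u"
    by (rule Assoc_natural_right) simp_all
  have "curry (y \<otimes>\<^sub>o xd) (counit y) = (RUnit C y \<triangleleft> xd) \<bullet> ((y \<triangleright> e) \<triangleleft> xd) \<bullet> (?A \<bullet> inv_arr C ?Q)
      \<bullet> ((y \<otimes>\<^sub>o xd) \<triangleright> k) \<bullet> inv_arr C (RUnit C (y \<otimes>\<^sub>o xd))"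
    by (simp add: dual_curry_def dual_counit_def right_whisker_Comp del: TensorArr_Ident)
  also have "\<dots> = (y \<triangleright> LUnit C xd) \<bullet> (Assoc C y ?u xd \<bullet> ((y \<triangleright> e) \<triangleleft> xd) \<bullet> inv_arr C ?S) \<bullet> inv_arr C ?B
      \<bullet> (?P \<bullet> ((y \<otimes>\<^sub>o xd) \<triangleright> k)) \<bullet> inv_arr C (RUnit C (y \<otimes>\<^sub>o xd))"
    using B(1) by (simp add: tri pent)
  also have "\<dots> = (y \<triangleright> (LUnit C xd \<bullet> (e \<triangleleft> xd) \<bullet> inv_arr C (Assoc C xd x xd) \<bullet> (xd \<triangleright> k)))
      \<bullet> Assoc C y xd ?u \<bullet> inv_arr C (RUnit C (y \<otimes>\<^sub>o xd))"
    unfolding eS kP B(2) by (simp add: left_whisker_Comp)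
  also have "\<dots> = ((y \<triangleright> RUnit C xd) \<bullet> Assoc C y xd ?u) \<bullet> inv_arr C (RUnit C (y \<otimes>\<^sub>o xd))"
    by (simp add: z)
  also have "\<dots> = Ident C (y \<otimes>\<^sub>o xd)"
    by (subst RUnit_TensorOb) simp_all
  finally show ?thesis .
qed

end

section \<open>The internal hom functor of \<open>x\<close> and its lax structure\<close>

locale internal_homs = linear_monoidal_category K C
  for K :: "('k, 'r) ring_scheme" and C :: "('o, 'm, 'k, 'x) monoidal_data_scheme" (structure) +
  fixes x h \<phi>
  assumes x_Ob [simp]: "x \<in> Ob C"
    and internal_hom: "y \<in> Ob C \<Longrightarrow> is_internal_hom C x y (h y) (\<phi> y)"
begin

abbreviation ev where "ev \<equiv> ihom_ev C x h \<phi>"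
abbreviation H where "H \<equiv> ihom_functor C x h \<phi>"

lemma h_Ob [simp]: "y \<in> Ob C \<Longrightarrow> h y \<in> Ob C"
  using internal_hom by (simp add: is_internal_hom_def)

lemma transpose_bij:
  "y \<in> Ob C \<Longrightarrow> w \<in> Ob C \<Longrightarrow> bij_betw (\<phi> y w) (Hom C (w \<otimes>\<^sub>o x) y) (Hom C w (h y))"
  using internal_hom by (simp add: is_internal_hom_def)

lemma transpose_natural:
  "y \<in> Ob C \<Longrightarrow> u \<in> Hom C w' w \<Longrightarrow> g \<in> Hom C (w \<otimes>\<^sub>o x) y \<Longrightarrow> \<phi> y w' (g \<bullet> (u \<triangleleft> x)) = \<phi> y w g \<bullet> u"
  using internal_hom by (simp add: is_internal_hom_def)

lemma transpose_simps [simp]: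
  assumes "g \<in> Arr C" "w \<in> Ob C" "Dom C g = w \<otimes>\<^sub>o x" "Cod C g = y"
  shows "\<phi> y w g \<in> Arr C" "Dom C (\<phi> y w g) = w" "Cod C (\<phi> y w g) = h y"
proof -
  have "\<phi> y w g \<in> Hom C w (h y)"
    using assms by (intro bij_betw_apply[OF transpose_bij]) (auto simp: Hom_iff)
  thus "\<phi> y w g \<in> Arr C" "Dom C (\<phi> y w g) = w" "Cod C (\<phi> y w g) = h y"
    by auto
qed

text \<open>\<open>ihom_ev\<close> is defined through \<open>inv_into\<close>. It is a genuine
  preimage because bijectivity of \<open>\<phi>\<close> puts the identity of \<open>h y\<close> in
  the image.\<close>

lemma
  assumes y: "y \<in> Ob C"
  shows ev_Hom: "ev y \<in> Hom C (h y \<otimes>\<^sub>o x) y" and transpose_ev: "\<phi> y (h y) (ev y) = Ident C (h y)"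
proof -
  have bij: "bij_betw (\<phi> y (h y)) (Hom C (h y \<otimes>\<^sub>o x) y) (Hom C (h y) (h y))"
    using y by (intro transpose_bij) auto
  have Id: "Ident C (h y) \<in> \<phi> y (h y) ` Hom C (h y \<otimes>\<^sub>o x) y"
    using bij y by (simp add: bij_betw_def Ident_closed)
  show "ev y \<in> Hom C (h y \<otimes>\<^sub>o x) y"
    unfolding ihom_ev_def by (rule inv_into_into[OF Id])
  show "\<phi> y (h y) (ev y) = Ident C (h y)"
    unfolding ihom_ev_def by (rule f_inv_into_f[OF Id])
qed

lemma ev_simps [simp]:
  assumes "y \<in> Ob C"
  shows "ev y \<in> Arr C" "Dom C (ev y) = h y \<otimes>\<^sub>o x" "Cod C (ev y) = y"
  using ev_Hom[OF assms] by auto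

text \<open>Yoneda: \<open>ev y\<close> has the identity as transpose, so by naturality the
  transpose of \<open>ev y \<bullet> (u \<triangleleft> x)\<close> is \<open>u\<close>
  itself.\<close>

lemma ev_faithful:
  assumes "ev y \<bullet> (u \<triangleleft> x) = ev y \<bullet> (v \<triangleleft> x)" "u \<in> Hom C w (h y)" "v \<in> Hom C w (h y)" "y \<in> Ob C"
  shows "u = v"
proof -
  have "\<phi> y w (ev y \<bullet> (u \<triangleleft> x)) = u" if "u \<in> Hom C w (h y)" for u
    using transpose_natural[OF assms(4) that ev_Hom[OF assms(4)]] HomD[OF that]
    by (simp add: transpose_ev[OF assms(4)])
  thus ?thesis
    using assms by metis
qed

text \<open>Both sides have the same transpose, and transposition is injective.\<close>

lemma ev_transpose:
  assumes [simp]: "g \<in> Arr C" "w \<in> Ob C" "Dom C g = w \<otimes>\<^sub>o x" "Cod C g = y"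
  shows "ev y \<bullet> (\<phi> y w g \<triangleleft> x) = g"
proof -
  have [simp]: "y \<in> Ob C"
    using Cod_Ob[OF assms(1)] by simp
  have "\<phi> y w (ev y \<bullet> (\<phi> y w g \<triangleleft> x)) = \<phi> y (h y) (ev y) \<bullet> \<phi> y w g"
    by (rule transpose_natural) (simp_all add: Hom_iff)
  also have "\<dots> = \<phi> y w g"
    by (simp add: transpose_ev)
  finally show ?thesis
    using transpose_bij[of y w] by (auto simp: bij_betw_def inj_on_def Hom_iff)
qed

lemma FOb_H [simp]: "FOb H = h"
  by (simp add: ihom_functor_def)

lemma FArr_H_simps [simp]:
  assumes "f \<in> Arr C"
  shows "FArr H f \<in> Arr C" "Dom C (FArr H f) = h (Dom C f)" "Cod C (FArr H f) = h (Cod C f)"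
  using assms by (simp_all add: ihom_functor_def)

text \<open>Naturality of the evaluation. Together with \<open>ev_faithful\<close> it characterises
  \<open>FArr H f\<close>, and later proofs use it in place of the definition.\<close>

lemma ev_FArr:
  assumes "f \<in> Arr C" "Dom C f = y" "Cod C f = z"
  shows "ev z \<bullet> (FArr H f \<triangleleft> x) = f \<bullet> ev y"
  using assms Dom_Ob[OF assms(1)] Cod_Ob[OF assms(1)] by (simp add: ihom_functor_def ev_transpose)

lemma FCon_H_simps [simp]:
  assumes "c \<in> Ob C" "y \<in> Ob C"
  shows "FCon H c y \<in> Arr C" "Dom C (FCon H c y) = c \<otimes>\<^sub>o h y" "Cod C (FCon H c y) = h (c \<otimes>\<^sub>o y)"
  using assms by (simp_all add: ihom_functor_def)

text \<open>The evaluation is a module transformation. This equation characterises the constraint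
  and is the way it enters the later proofs.\<close>

lemma ev_FCon:
  assumes "c \<in> Ob C" "y \<in> Ob C"
  shows "ev (c \<otimes>\<^sub>o y) \<bullet> (FCon H c y \<triangleleft> x) = (c \<triangleright> ev y) \<bullet> Assoc C c (h y) x"
  using assms by (simp add: ihom_functor_def ev_transpose)

text \<open>Every law is tested after \<open>ev\<close>, where it reduces to functoriality or
  linearity of composition and tensor product.\<close>

lemma linear_ihom_functor: "linear_endofunctor K C h (FArr H)"
  unfolding linear_endofunctor_def
proof (intro conjI ballI allI impI)
  show "FArr H f \<in> Hom C (h a) (h b)" if "f \<in> Hom C a b" for a b f
    using that by (auto simp: Hom_iff)
  show "FArr H (Ident C a) = Ident C (h a)" if [simp]: "a \<in> Ob C" for a
    by (rule ev_faithful[where y = a and w = "h a"]) (simp_all add: Hom_iff ev_FArr)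
  show "FArr H (g \<bullet> f) = FArr H g \<bullet> FArr H f" if f: "f \<in> Hom C a b" and g: "g \<in> Hom C b c" for a b c f g
  proof -
    note [simp] = HomD[OF f] HomD[OF g]
    have "ev c \<bullet> ((FArr H g \<bullet> FArr H f) \<triangleleft> x) = (ev c \<bullet> (FArr H g \<triangleleft> x)) \<bullet> (FArr H f \<triangleleft> x)"
      by (simp add: right_whisker_Comp)
    also have "\<dots> = (g \<bullet> f) \<bullet> ev a"
      by (simp add: ev_FArr)
    also have "\<dots> = ev c \<bullet> (FArr H (g \<bullet> f) \<triangleleft> x)"
      by (subst ev_FArr[where y = a]) simp_all
    finally show ?thesis
      by (rule ev_faithful[where y = c and w = "h a", symmetric]) (simp_all add: Hom_iff)
  qed
  show "FArr H (ArrAdd C f g) = ArrAdd C (FArr H f) (FArr H g)"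
    if f: "f \<in> Hom C a b" and g: "g \<in> Hom C a b" for a b f g
  proof -
    note [simp] = HomD[OF f] HomD[OF g]
    have Hf: "FArr H f \<in> Hom C (h a) (h b)" and Hg: "FArr H g \<in> Hom C (h a) (h b)"
      by (simp_all add: Hom_iff)
    note sum [simp] = HomD[OF ArrAdd_closed[OF f g]]
    have x: "FArr H f \<triangleleft> x \<in> Hom C (h a \<otimes>\<^sub>o x) (h b \<otimes>\<^sub>o x)" "FArr H g \<triangleleft> x \<in> Hom C (h a \<otimes>\<^sub>o x) (h b \<otimes>\<^sub>o x)"
      by (simp_all add: Hom_iff)
    have "ev b \<bullet> (ArrAdd C (FArr H f) (FArr H g) \<triangleleft> x) = ArrAdd C (ev b \<bullet> (FArr H f \<triangleleft> x)) (ev b \<bullet> (FArr H g \<triangleleft> x))"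
      using TensorArr_add_left[OF Hf Hg Ident_closed[OF x_Ob]] Comp_add_right[OF x ev_Hom] by simp
    also have "\<dots> = ev b \<bullet> (FArr H (ArrAdd C f g) \<triangleleft> x)"
      using Comp_add_left[OF ev_Hom f g] by (simp add: ev_FArr)
    finally show ?thesis
      by (rule ev_faithful[where y = b and w = "h a", symmetric])
        (use ArrAdd_closed[OF Hf Hg] in \<open>simp_all add: Hom_iff\<close>)
  qed
  show "FArr H (ArrScale C r f) = ArrScale C r (FArr H f)" if r: "r \<in> carrier K" and f [simp]: "f \<in> Arr C" for r f
  proof -
    define a b where "a = Dom C f" and "b = Cod C f"
    have fab: "f \<in> Hom C a b"
      by (simp add: Hom_iff a_def b_def)
    note [simp] = HomD[OF fab]
    have Hf: "FArr H f \<in> Hom C (h a) (h b)"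
      by (simp_all add: Hom_iff)
    note [simp] = HomD[OF ArrScale_closed[OF r fab]]
    have x: "FArr H f \<triangleleft> x \<in> Hom C (h a \<otimes>\<^sub>o x) (h b \<otimes>\<^sub>o x)"
      by (simp_all add: Hom_iff)
    have "ev b \<bullet> (ArrScale C r (FArr H f) \<triangleleft> x) = ArrScale C r (ev b \<bullet> (FArr H f \<triangleleft> x))"
      using TensorArr_scale_left[OF r Hf Ident_closed[OF x_Ob]] Comp_scale_right[OF r x ev_Hom] by simp
    also have "\<dots> = ev b \<bullet> (FArr H (ArrScale C r f) \<triangleleft> x)"
      using Comp_scale_left[OF r ev_Hom fab] by (simp add: ev_FArr)
    finally show ?thesis
      by (rule ev_faithful[where y = b and w = "h a", symmetric])
        (use ArrScale_closed[OF r Hf] in \<open>simp_all add: Hom_iff\<close>)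
  qed
qed simp

text \<open>After \<open>ev\<close>, naturality of the constraint becomes naturality of the
  associator, the associativity law becomes the pentagon, and the unit law becomes
  \<open>LUnit_TensorOb\<close>.\<close>

lemma lax_ihom_functor: "lax_module_functor K C H"
  unfolding lax_module_functor_def
proof (intro conjI ballI allI impI)
  show "linear_endofunctor K C (FOb H) (FArr H)"
    by (simp add: linear_ihom_functor)
  show "FCon H c y \<in> Hom C (c \<otimes>\<^sub>o FOb H y) (FOb H (c \<otimes>\<^sub>o y))" if "c \<in> Ob C" "y \<in> Ob C" for c y
    using that by (simp add: Hom_iff)
  show "FArr H (f \<otimes>\<^sub>m g) \<bullet> FCon H c y = FCon H c' y' \<bullet> (f \<otimes>\<^sub>m FArr H g)"
    if f: "f \<in> Hom C c c'" and g: "g \<in> Hom C y y'" for c c' y y' f g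
  proof -
    note [simp] = HomD[OF f] HomD[OF g]
    have "ev (c' \<otimes>\<^sub>o y') \<bullet> ((FArr H (f \<otimes>\<^sub>m g) \<bullet> FCon H c y) \<triangleleft> x)
        = (ev (c' \<otimes>\<^sub>o y') \<bullet> (FArr H (f \<otimes>\<^sub>m g) \<triangleleft> x)) \<bullet> (FCon H c y \<triangleleft> x)"
      by (simp add: right_whisker_Comp)
    also have "\<dots> = (f \<otimes>\<^sub>m g) \<bullet> (ev (c \<otimes>\<^sub>o y) \<bullet> (FCon H c y \<triangleleft> x))"
      by (simp add: ev_FArr)
    also have "\<dots> = ((f \<otimes>\<^sub>m g) \<bullet> (c \<triangleright> ev y)) \<bullet> Assoc C c (h y) x"
      by (simp add: ev_FCon)
    also have "(f \<otimes>\<^sub>m g) \<bullet> (c \<triangleright> ev y) = (c' \<triangleright> ev y') \<bullet> (f \<otimes>\<^sub>m (FArr H g \<triangleleft> x))"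
      by (simp add: interchange ev_FArr)
    also have "\<dots> \<bullet> Assoc C c (h y) x = (c' \<triangleright> ev y') \<bullet> (f \<otimes>\<^sub>m (FArr H g \<triangleleft> x)) \<bullet> Assoc C c (h y) x"
      by simp
    also have "(f \<otimes>\<^sub>m (FArr H g \<triangleleft> x)) \<bullet> Assoc C c (h y) x = Assoc C c' (h y') x \<bullet> ((f \<otimes>\<^sub>m FArr H g) \<triangleleft> x)"
      by (rule Assoc_natural[symmetric]) (simp_all add: Hom_iff)
    also have "(c' \<triangleright> ev y') \<bullet> Assoc C c' (h y') x \<bullet> ((f \<otimes>\<^sub>m FArr H g) \<triangleleft> x)
        = (ev (c' \<otimes>\<^sub>o y') \<bullet> (FCon H c' y' \<triangleleft> x)) \<bullet> ((f \<otimes>\<^sub>m FArr H g) \<triangleleft> x)"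
      by (simp add: ev_FCon)
    also have "\<dots> = ev (c' \<otimes>\<^sub>o y') \<bullet> ((FCon H c' y' \<bullet> (f \<otimes>\<^sub>m FArr H g)) \<triangleleft> x)"
      by (simp add: right_whisker_Comp)
    finally show ?thesis
      by (rule ev_faithful[where y = "c' \<otimes>\<^sub>o y'" and w = "c \<otimes>\<^sub>o h y"]) (simp_all add: Hom_iff)
  qed
  show "FArr H (Assoc C c d y) \<bullet> FCon H (c \<otimes>\<^sub>o d) y
      = FCon H c (d \<otimes>\<^sub>o y) \<bullet> (c \<triangleright> FCon H d y) \<bullet> Assoc C c d (FOb H y)"
    if [simp]: "c \<in> Ob C" "d \<in> Ob C" "y \<in> Ob C" for c d y
  proof -
    let ?e = "ev (c \<otimes>\<^sub>o d \<otimes>\<^sub>o y)"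
    let ?A = "Assoc C c d (h y) \<triangleleft> x"
    have "?e \<bullet> ((FArr H (Assoc C c d y) \<bullet> FCon H (c \<otimes>\<^sub>o d) y) \<triangleleft> x)
        = (?e \<bullet> (FArr H (Assoc C c d y) \<triangleleft> x)) \<bullet> (FCon H (c \<otimes>\<^sub>o d) y \<triangleleft> x)"
      by (simp add: right_whisker_Comp)
    also have "\<dots> = Assoc C c d y \<bullet> (ev ((c \<otimes>\<^sub>o d) \<otimes>\<^sub>o y) \<bullet> (FCon H (c \<otimes>\<^sub>o d) y \<triangleleft> x))"
      by (simp add: ev_FArr)
    also have "\<dots> = (Assoc C c d y \<bullet> ((c \<otimes>\<^sub>o d) \<triangleright> ev y)) \<bullet> Assoc C (c \<otimes>\<^sub>o d) (h y) x"
      by (simp add: ev_FCon)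
    also have "Assoc C c d y \<bullet> ((c \<otimes>\<^sub>o d) \<triangleright> ev y) = (c \<triangleright> (d \<triangleright> ev y)) \<bullet> Assoc C c d (h y \<otimes>\<^sub>o x)"
      by (rule Assoc_natural_right) simp_all
    also have "\<dots> \<bullet> Assoc C (c \<otimes>\<^sub>o d) (h y) x
        = (c \<triangleright> ((d \<triangleright> ev y) \<bullet> Assoc C d (h y) x)) \<bullet> Assoc C c (d \<otimes>\<^sub>o h y) x \<bullet> ?A"
      by (simp add: pentagon left_whisker_Comp)
    \<comment> \<open>\<open>ev_FCon\<close> is read backwards under the whiskering by
      \<open>c\<close>, which introduces the inner constraint. Applied again further down, it
      introduces the outer one.\<close>
    also have "(d \<triangleright> ev y) \<bullet> Assoc C d (h y) x = ev (d \<otimes>\<^sub>o y) \<bullet> (FCon H d y \<triangleleft> x)"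
      by (simp add: ev_FCon)
    also have "(c \<triangleright> \<dots>) \<bullet> Assoc C c (d \<otimes>\<^sub>o h y) x \<bullet> ?A
        = (c \<triangleright> ev (d \<otimes>\<^sub>o y)) \<bullet> ((c \<triangleright> (FCon H d y \<triangleleft> x)) \<bullet> Assoc C c (d \<otimes>\<^sub>o h y) x) \<bullet> ?A"
      by (simp add: left_whisker_Comp)
    also have "(c \<triangleright> (FCon H d y \<triangleleft> x)) \<bullet> Assoc C c (d \<otimes>\<^sub>o h y) x
        = Assoc C c (h (d \<otimes>\<^sub>o y)) x \<bullet> ((c \<triangleright> FCon H d y) \<triangleleft> x)"
      by (rule Assoc_natural_middle[symmetric]) simp_all
    also have "(c \<triangleright> ev (d \<otimes>\<^sub>o y)) \<bullet> \<dots> \<bullet> ?A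
        = ((c \<triangleright> ev (d \<otimes>\<^sub>o y)) \<bullet> Assoc C c (h (d \<otimes>\<^sub>o y)) x) \<bullet> ((c \<triangleright> FCon H d y) \<triangleleft> x) \<bullet> ?A"
      by simp
    also have "\<dots> = (?e \<bullet> (FCon H c (d \<otimes>\<^sub>o y) \<triangleleft> x)) \<bullet> ((c \<triangleright> FCon H d y) \<triangleleft> x) \<bullet> ?A"
      by (simp add: ev_FCon)
    also have "\<dots> = ?e \<bullet> ((FCon H c (d \<otimes>\<^sub>o y) \<bullet> (c \<triangleright> FCon H d y) \<bullet> Assoc C c d (h y)) \<triangleleft> x)"
      by (simp add: right_whisker_Comp)
    finally show ?thesis
      unfolding FOb_H by (rule ev_faithful[where y = "c \<otimes>\<^sub>o d \<otimes>\<^sub>o y" and w = "(c \<otimes>\<^sub>o d) \<otimes>\<^sub>o h y"]) (simp_all add: Hom_iff)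
  qed
  show "FArr H (LUnit C y) \<bullet> FCon H (UnitOb C) y = LUnit C (FOb H y)" if [simp]: "y \<in> Ob C" for y
  proof -
    let ?u = "UnitOb C"
    have "ev y \<bullet> ((FArr H (LUnit C y) \<bullet> FCon H ?u y) \<triangleleft> x)
        = (ev y \<bullet> (FArr H (LUnit C y) \<triangleleft> x)) \<bullet> (FCon H ?u y \<triangleleft> x)"
      by (simp add: right_whisker_Comp)
    also have "\<dots> = (LUnit C y \<bullet> (?u \<triangleright> ev y)) \<bullet> Assoc C ?u (h y) x"
      by (simp add: ev_FArr ev_FCon)
    also have "\<dots> = ev y \<bullet> (LUnit C (h y \<otimes>\<^sub>o x) \<bullet> Assoc C ?u (h y) x)"
      by (simp add: LUnit_natural[OF ev_Hom])
    also have "\<dots> = ev y \<bullet> (LUnit C (h y) \<triangleleft> x)"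
      by (simp add: LUnit_TensorOb)
    finally show ?thesis
      unfolding FOb_H by (rule ev_faithful[where y = y and w = "?u \<otimes>\<^sub>o h y"]) (simp_all add: Hom_iff)
  qed
qed

text \<open>The evaluation is \<open>ev\<close> at the unit. The first zig-zag identity is the
  definition of \<open>k\<close> read through \<open>ev_FCon\<close>; the second follows from the
  first because \<open>ev\<close> is faithful.\<close>

lemma is_right_dual_if_strong:
  assumes "strong_module_functor K C H"
  shows "is_right_dual C x (h (UnitOb C))"
proof -
  let ?u = "UnitOb C"
  let ?D = "h ?u"
  have con [simp]: "iso_arr C (FCon H x ?u)"
    using assms by (simp add: strong_module_functor_def)
  define j where "j = inv_arr C (RUnit C x) \<bullet> LUnit C x"
  have j [simp]: "j \<in> Arr C" "Dom C j = ?u \<otimes>\<^sub>o x" "Cod C j = x \<otimes>\<^sub>o ?u"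
    by (simp_all add: j_def)
  define k where "k = inv_arr C (FCon H x ?u) \<bullet> \<phi> (x \<otimes>\<^sub>o ?u) ?u j"
  have k: "k \<in> Arr C" "Dom C k = ?u" "Cod C k = x \<otimes>\<^sub>o ?D"
    by (simp_all add: k_def)
  \<comment> \<open>Possible before any zig-zag identity is known, so \<open>counit_curry\<close>
    becomes available as soon as \<open>z1\<close> is proved.\<close>
  interpret dual_pair K C x ?D "ev ?u" k
    by unfold_locales (use k ev_Hom in \<open>simp_all add: Hom_iff\<close>)
  have "((x \<triangleright> ev ?u) \<bullet> Assoc C x ?D x) \<bullet> (k \<triangleleft> x) = ev (x \<otimes>\<^sub>o ?u) \<bullet> ((FCon H x ?u \<bullet> k) \<triangleleft> x)"
    by (simp add: right_whisker_Comp flip: ev_FCon)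
  also have "FCon H x ?u \<bullet> k = \<phi> (x \<otimes>\<^sub>o ?u) ?u j"
    by (simp add: k_def)
  also have "ev (x \<otimes>\<^sub>o ?u) \<bullet> (\<dots> \<triangleleft> x) = j"
    by (simp add: ev_transpose)
  finally have z1: "RUnit C x \<bullet> (x \<triangleright> ev ?u) \<bullet> Assoc C x ?D x \<bullet> (k \<triangleleft> x) = LUnit C x"
    by (simp add: j_def)
  \<comment> \<open>\<open>LUnit C ?D \<bullet> ?c\<close> is the second zig-zag composite, so it
    has to be shown to be the identity.\<close>
  let ?c = "curry ?D (ev ?u)"
  have "ev ?u \<bullet> ((LUnit C ?D \<bullet> ?c) \<triangleleft> x) = ev ?u \<bullet> (LUnit C ?D \<triangleleft> x) \<bullet> (?c \<triangleleft> x)"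
    by (simp add: right_whisker_Comp)
  also have "\<dots> = (ev ?u \<bullet> LUnit C (?D \<otimes>\<^sub>o x)) \<bullet> Assoc C ?u ?D x \<bullet> (?c \<triangleleft> x)"
    by (simp flip: LUnit_TensorOb)
  also have "\<dots> = (LUnit C ?u \<bullet> (?u \<triangleright> ev ?u)) \<bullet> Assoc C ?u ?D x \<bullet> (?c \<triangleleft> x)"
    by (simp add: LUnit_natural[OF ev_Hom])
  \<comment> \<open>The left unitor at the unit, left over from naturality, must agree with the
    right unitor in the counit; \<open>LUnit_UnitOb\<close> provides this.\<close>
  also have "\<dots> = counit ?u \<bullet> (?c \<triangleleft> x)"
    by (simp add: dual_counit_def LUnit_UnitOb)
  also have "\<dots> = ev ?u \<bullet> (Ident C ?D \<triangleleft> x)"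
    by (simp add: counit_curry[OF z1])
  finally have "LUnit C ?D \<bullet> ?c = Ident C ?D"
    by (rule ev_faithful[where y = ?u and w = ?D]) (simp_all add: Hom_iff)
  hence "(LUnit C ?D \<bullet> (ev ?u \<triangleleft> ?D) \<bullet> inv_arr C (Assoc C ?D x ?D) \<bullet> (?D \<triangleright> k)) \<bullet> inv_arr C (RUnit C ?D)
      = Ident C ?D"
    by (simp add: dual_curry_def)
  hence z2: "LUnit C ?D \<bullet> (ev ?u \<triangleleft> ?D) \<bullet> inv_arr C (Assoc C ?D x ?D) \<bullet> (?D \<triangleright> k) = RUnit C ?D"
    using Comp_inv_arr_eq_Ident_iff[of "RUnit C ?D"
        "LUnit C ?D \<bullet> (ev ?u \<triangleleft> ?D) \<bullet> inv_arr C (Assoc C ?D x ?D) \<bullet> (?D \<triangleright> k)"] by simp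
  have "right_dual_data C x ?D (ev ?u) k"
    using z1 z2 e_Hom k_Hom by (simp add: right_dual_data_iff)
  thus ?thesis
    by (auto simp: is_right_dual_def)
qed

text \<open>The comparison \<open>\<theta> y\<close> is the transpose of the counit. Laws for
  \<open>\<theta>\<close> are tested after \<open>ev\<close>, where it becomes the counit:
  naturality is \<open>counit_natural\<close>, compatibility with the constraints is
  \<open>counit_TensorOb\<close>.\<close>

lemma right_dual_module_functor_iso:
  assumes "is_right_dual C x xd"
  obtains \<theta> where "module_functor_iso C (tensor_right_functor C xd) H \<theta>"
proof -
  obtain e k where xd: "xd \<in> Ob C" and ek: "right_dual_data C x xd e k"
    using assms by (auto simp: is_right_dual_def)
  interpret dual_pair K C x xd e k
    by unfold_locales (use xd ek in \<open>simp_all add: right_dual_data_iff\<close>)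
  note zigzag = ek[unfolded right_dual_data_iff[OF x_Ob xd], THEN conjunct2, THEN conjunct2]
  define \<theta> where "\<theta> y = \<phi> y (y \<otimes>\<^sub>o xd) (counit y)" for y
  have \<theta> [simp]: "\<theta> y \<in> Arr C" "Dom C (\<theta> y) = y \<otimes>\<^sub>o xd" "Cod C (\<theta> y) = h y"
    and ev_\<theta>: "ev y \<bullet> (\<theta> y \<triangleleft> x) = counit y" if "y \<in> Ob C" for y
    using that by (simp_all add: \<theta>_def ev_transpose)
  have "module_functor_iso C (tensor_right_functor C xd) H \<theta>"
    unfolding module_functor_iso_def
  proof (intro conjI ballI allI impI)
    show "\<theta> y \<in> Hom C (FOb (tensor_right_functor C xd) y) (FOb H y)" if "y \<in> Ob C" for y
      using that by (simp add: Hom_iff tensor_right_functor_def)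
    show "iso_arr C (\<theta> y)" if [simp]: "y \<in> Ob C" for y
    proof (rule iso_arrI)
      \<comment> \<open>The inverse is \<open>ev y\<close> curried along the dual. The second
        zig-zag identity gives one composite, the first gives the other.\<close>
      let ?c = "curry (h y) (ev y)"
      have "?c \<bullet> \<theta> y = curry (y \<otimes>\<^sub>o xd) (ev y \<bullet> (\<theta> y \<triangleleft> x))"
        by (rule curry_natural[symmetric]) simp_all
      thus "?c \<bullet> \<theta> y = Ident C (Dom C (\<theta> y))"
        using zigzag by (simp add: ev_\<theta> curry_counit)
      have "ev y \<bullet> ((\<theta> y \<bullet> ?c) \<triangleleft> x) = (ev y \<bullet> (\<theta> y \<triangleleft> x)) \<bullet> (?c \<triangleleft> x)"
        by (simp add: right_whisker_Comp)
      also have "\<dots> = ev y \<bullet> (Ident C (h y) \<triangleleft> x)"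
        using zigzag by (simp add: ev_\<theta> counit_curry)
      finally show "\<theta> y \<bullet> ?c = Ident C (Cod C (\<theta> y))"
        unfolding \<theta>(3)[OF that] by (rule ev_faithful[where y = y and w = "h y"]) (simp_all add: Hom_iff)
    qed simp_all
    show "FArr H f \<bullet> \<theta> y = \<theta> z \<bullet> FArr (tensor_right_functor C xd) f" if f: "f \<in> Hom C y z" for y z f
    proof -
      note [simp] = HomD[OF f]
      have "ev z \<bullet> ((FArr H f \<bullet> \<theta> y) \<triangleleft> x) = (ev z \<bullet> (FArr H f \<triangleleft> x)) \<bullet> (\<theta> y \<triangleleft> x)"
        by (simp add: right_whisker_Comp)
      also have "\<dots> = f \<bullet> (ev y \<bullet> (\<theta> y \<triangleleft> x))"
        by (simp add: ev_FArr)
      also have "\<dots> = (ev z \<bullet> (\<theta> z \<triangleleft> x)) \<bullet> ((f \<triangleleft> xd) \<triangleleft> x)"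
        by (simp add: ev_\<theta> counit_natural)
      also have "\<dots> = ev z \<bullet> ((\<theta> z \<bullet> (f \<triangleleft> xd)) \<triangleleft> x)"
        by (simp add: right_whisker_Comp)
      finally show ?thesis
        unfolding tensor_right_functor_def module_functor_data.simps
        by (rule ev_faithful[where y = z and w = "y \<otimes>\<^sub>o xd"]) (simp_all add: Hom_iff)
    qed
    show "\<theta> (c \<otimes>\<^sub>o y) \<bullet> FCon (tensor_right_functor C xd) c y = FCon H c y \<bullet> (c \<triangleright> \<theta> y)"
      if [simp]: "c \<in> Ob C" "y \<in> Ob C" for c y
    proof -
      \<comment> \<open>The constraint of the tensor functor is the inverse of \<open>?A\<close>.
        The equation is first proved with \<open>?A\<close> moved to the other side, and
        \<open>?A\<close> is cancelled at the end.\<close>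
      let ?A = "Assoc C c y xd" and ?e = "ev (c \<otimes>\<^sub>o y)"
      have "?e \<bullet> ((FCon H c y \<bullet> (c \<triangleright> \<theta> y) \<bullet> ?A) \<triangleleft> x)
          = (?e \<bullet> (FCon H c y \<triangleleft> x)) \<bullet> ((c \<triangleright> \<theta> y) \<triangleleft> x) \<bullet> (?A \<triangleleft> x)"
        by (simp add: right_whisker_Comp)
      also have "\<dots> = (c \<triangleright> ev y) \<bullet> (Assoc C c (h y) x \<bullet> ((c \<triangleright> \<theta> y) \<triangleleft> x)) \<bullet> (?A \<triangleleft> x)"
        by (simp add: ev_FCon)
      also have "Assoc C c (h y) x \<bullet> ((c \<triangleright> \<theta> y) \<triangleleft> x) = (c \<triangleright> (\<theta> y \<triangleleft> x)) \<bullet> Assoc C c (y \<otimes>\<^sub>o xd) x"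
        by (rule Assoc_natural_middle) simp_all
      also have "(c \<triangleright> ev y) \<bullet> \<dots> \<bullet> (?A \<triangleleft> x)
          = (c \<triangleright> (ev y \<bullet> (\<theta> y \<triangleleft> x))) \<bullet> Assoc C c (y \<otimes>\<^sub>o xd) x \<bullet> (?A \<triangleleft> x)"
        by (simp add: left_whisker_Comp)
      also have "\<dots> = ?e \<bullet> (\<theta> (c \<otimes>\<^sub>o y) \<triangleleft> x)"
        by (simp add: ev_\<theta> counit_TensorOb)
      finally have "FCon H c y \<bullet> (c \<triangleright> \<theta> y) \<bullet> ?A = \<theta> (c \<otimes>\<^sub>o y)"
        by (rule ev_faithful[where y = "c \<otimes>\<^sub>o y" and w = "(c \<otimes>\<^sub>o y) \<otimes>\<^sub>o xd"]) (simp_all add: Hom_iff)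
      hence "\<theta> (c \<otimes>\<^sub>o y) \<bullet> inv_arr C ?A = (FCon H c y \<bullet> (c \<triangleright> \<theta> y) \<bullet> ?A) \<bullet> inv_arr C ?A"
        by (simp only:)
      thus ?thesis
        by (simp add: tensor_right_functor_def)
    qed
  qed
  thus thesis
    by (rule that)
qed

text \<open>The comparison at the unit is precomposed with the inverse left unitor of
  \<open>xd\<close>.\<close>

lemma isomorphic_ob_right_dual:
  assumes "is_right_dual C x xd"
  shows "isomorphic_ob C xd (h (UnitOb C))"
proof -
  have [simp]: "xd \<in> Ob C"
    using assms by (simp add: is_right_dual_def)
  obtain \<theta> where "module_functor_iso C (tensor_right_functor C xd) H \<theta>"
    using right_dual_module_functor_iso[OF assms] .
  hence "\<theta> (UnitOb C) \<in> Hom C (UnitOb C \<otimes>\<^sub>o xd) (h (UnitOb C))" "iso_arr C (\<theta> (UnitOb C))"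
    by (simp_all add: module_functor_iso_def tensor_right_functor_def)
  hence "\<theta> (UnitOb C) \<bullet> inv_arr C (LUnit C xd) \<in> Hom C xd (h (UnitOb C))"
    "iso_arr C (\<theta> (UnitOb C) \<bullet> inv_arr C (LUnit C xd))"
    by (auto simp: Hom_iff intro!: iso_arr_Comp)
  thus ?thesis
    by (auto simp: isomorphic_ob_def)
qed

end

theorem proposition5p2:
  fixes K :: "('k, 'r) ring_scheme"
    and C :: "('o, 'm, 'k, 'x) monoidal_data_scheme"
    and x :: 'o
    and h :: "'o \<Rightarrow> 'o"
    and \<phi> :: "'o \<Rightarrow> 'o \<Rightarrow> 'm \<Rightarrow> 'm"
  assumes "algebraically_closed K"
    and "linear_monoidal_category K C"
    and "right_closed C"
    and "x \<in> Ob C"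
    and "\<And>y. y \<in> Ob C \<Longrightarrow> is_internal_hom C x y (h y) (\<phi> y)"
  shows "(strong_module_functor K C (ihom_functor C x h \<phi>) \<longleftrightarrow> (\<exists>xd. is_right_dual C x xd)) \<and>
    (\<forall>xd. is_right_dual C x xd \<longrightarrow>
       isomorphic_ob C xd (h (UnitOb C)) \<and>
       isomorphic_module_functors K C (ihom_functor C x h \<phi>) (tensor_right_functor C xd))"
proof -
  interpret linear_monoidal_category K C
    by fact
  interpret internal_homs K C x h \<phi>
    by unfold_locales fact+
  have strong: "strong_module_functor K C (tensor_right_functor C xd)" if "is_right_dual C x xd" for xd
    using that by (simp add: is_right_dual_def strong_tensor_right_functor)
  have "isomorphic_module_functors K C H (tensor_right_functor C xd)" if xd: "is_right_dual C x xd" for xd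
  proof -
    obtain \<theta> where "module_functor_iso C (tensor_right_functor C xd) H \<theta>"
      using right_dual_module_functor_iso[OF xd] .
    thus ?thesis
      using strong[OF xd] lax_ihom_functor module_functor_iso_inverse
      by (auto simp: isomorphic_module_functors_def strong_module_functor_def)
  qed
  \<comment> \<open>Strength is inherited from the tensor functor along the comparison, using that
    the internal hom is already known to be lax.\<close>
  moreover have "strong_module_functor K C H" if xd: "is_right_dual C x xd" for xd
    using right_dual_module_functor_iso[OF xd] strong_module_functor_iso[OF strong[OF xd] lax_ihom_functor]
    by blast
  ultimately show ?thesis
    using is_right_dual_if_strong isomorphic_ob_right_dual by blast
qed

end
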